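(* Let $A$ and $B$ be two measurable subsets of $\mathbb R^n$. Then the following propositions are equivalent: (i) There exists a positive constant $C_1(n,A,B)$ such that for each $f\in L^2(\mathbb R^n;\mathbb C)$, $$\int_{\mathbb R^n}|f(x)|^2\,dx\le C_1(n,A,B)\Big(\int_A|f(x)|^2\,dx+\int_B|\hat f(\xi)|^2\,d\xi\Big).$$ (ii) There exists a positive constant $C_2(n,A,B)$ such that for each $T>0$ and each $u_0\in L^2(\mathbb R^n;\mathbb C)$, $$\int_{\mathbb R^n}|u_0(x)|^2\,dx\le C_2(n,A,B)\Big(\int_A|u_0(x)|^2\,dx+\int_{2TB}|u(x,T;u_0)|^2\,dx\Big).$$ Furthermore, when one of the two propositions (i) and (ii) holds, the constants $C_1(n,A,B)$ and $C_2(n,A,B)$ can be chosen as the same number.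
   Context: Here $n\in\{1,2,\dots\}$ is fixed. For $u_0\in L^2(\mathbb R^n;\mathbb C)$ and $t\ge 0$, $u(x,t;u_0)=(e^{i\Delta t}u_0)(x)$ denotes the solution of the free Schrödinger equation $i\partial_t u+\Delta u=0$ in $\mathbb R^n\times(0,\infty)$ with $u(x,0)=u_0(x)$. The Fourier transform is $\hat f(\xi)=(2\pi)^{-n/2}\int_{\mathbb R^n}f(x)e^{-ix\cdot\xi}\,dx$ for $f\in L^1\cap L^2$, extended to $L^2(\mathbb R^n;\mathbb C)$ in the usual way. For $\lambda\in\mathbb R$ and $B\subset\mathbb R^n$, $\lambda B=\{\lambda x: x\in B\}$. *)

theory Defs
  imports "HOL-Analysis.Analysis"
begin

definition square_integrable :: "(real ^ 'n \<Rightarrow> complex) \<Rightarrow> bool" where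
  "square_integrable f \<longleftrightarrow>
     f \<in> borel_measurable lebesgue \<and> integrable lebesgue (\<lambda>x. (cmod (f x))\<^sup>2)"

(* The extended-valued integral is used so that convergence cannot hold spuriously
   through the Bochner integral of a non-integrable function being 0. *)
definition L2_tendsto :: "(nat \<Rightarrow> real ^ 'n \<Rightarrow> complex) \<Rightarrow> (real ^ 'n \<Rightarrow> complex) \<Rightarrow> bool" where
  "L2_tendsto F f \<longleftrightarrow>
     (\<lambda>k. \<integral>\<^sup>+ x. ennreal ((cmod (F k x - f x))\<^sup>2) \<partial>lebesgue) \<longlonglongrightarrow> 0"

definition fourier_integral :: "(real ^ 'n \<Rightarrow> complex) \<Rightarrow> real ^ 'n \<Rightarrow> complex" where
  "fourier_integral f \<xi> =
     complex_of_real ((2 * pi) powr (- real CARD('n) / 2)) *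
     (LINT x|lebesgue. f x * exp (- \<i> * complex_of_real (x \<bullet> \<xi>)))"

(* The graph of the L2 Fourier transform: the closure in L2 x L2 of the graph of
   the Fourier integral on the dense subspace of functions in both L1 and L2. *)
definition is_fourier_transform :: "(real ^ 'n \<Rightarrow> complex) \<Rightarrow> (real ^ 'n \<Rightarrow> complex) \<Rightarrow> bool" where
  "is_fourier_transform f g \<longleftrightarrow> square_integrable g \<and>
     (\<exists>F. (\<forall>k. integrable lebesgue (F k) \<and> square_integrable (F k)) \<and>
          L2_tendsto F f \<and> L2_tendsto (\<lambda>k. fourier_integral (F k)) g)"

(* By Plancherel a transform of a square integrable function exists and is unique up to
   a null set, so the choice only picks a representative. *)
definition fourier :: "(real ^ 'n \<Rightarrow> complex) \<Rightarrow> real ^ 'n \<Rightarrow> complex" where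
  "fourier f = (SOME g. is_fourier_transform f g)"

(* The operator exp (i t Laplacian) on L2, in the sense of the functional calculus: the
   Fourier transform turns the Laplacian into multiplication by -|xi|^2, and the Schroedinger
   equation into i d/dt v(xi,t) = |xi|^2 v(xi,t) with v the transform of u in x.  The choice
   is again only that of a representative up to a null set. *)
definition schrodinger :: "real \<Rightarrow> (real ^ 'n \<Rightarrow> complex) \<Rightarrow> real ^ 'n \<Rightarrow> complex" where
  "schrodinger t u0 = (SOME u. square_integrable u \<and>
     (AE \<xi> in lebesgue.
        fourier u \<xi> = exp (- \<i> * complex_of_real (t * (norm \<xi>)\<^sup>2)) * fourier u0 \<xi>))"

definition uncertainty_inequality :: "real \<Rightarrow> (real ^ 'n) set \<Rightarrow> (real ^ 'n) set \<Rightarrow> bool" where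
  "uncertainty_inequality C A B \<longleftrightarrow>
     (\<forall>f. square_integrable f \<longrightarrow>
        (LINT x|lebesgue. (cmod (f x))\<^sup>2) \<le>
          C * ((LINT x:A|lebesgue. (cmod (f x))\<^sup>2) +
               (LINT \<xi>:B|lebesgue. (cmod (fourier f \<xi>))\<^sup>2)))"

definition observability_inequality :: "real \<Rightarrow> (real ^ 'n) set \<Rightarrow> (real ^ 'n) set \<Rightarrow> bool" where
  "observability_inequality C A B \<longleftrightarrow>
     (\<forall>T>0. \<forall>u0. square_integrable u0 \<longrightarrow>
        (LINT x|lebesgue. (cmod (u0 x))\<^sup>2) \<le>
          C * ((LINT x:A|lebesgue. (cmod (u0 x))\<^sup>2) +
               (LINT x:((\<lambda>y. (2 * T) *\<^sub>R y) ` B)|lebesgue. (cmod (schrodinger T u0 x))\<^sup>2)))"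

end

theory Submission
  imports Defs "HOL-Probability.Characteristic_Functions" "HOL-Complex_Analysis.Conformal_Mappings"
begin

text \<open>
  The two inequalities are the same inequality, because the free Schroedinger evolution is a
  Fourier transform in disguise. Expanding \<open>\<bar>x - y\<bar>\<^sup>2\<close> in the kernel
  \<open>exp (\<i> \<bar>x - y\<bar>\<^sup>2 / (4 T))\<close> shows that, for a constant \<open>c\<close> of modulus \<open>(2 T)\<close> to the power \<open>- n / 2\<close>,

  \<open>schrodinger T f x = c * exp (\<i> \<bar>x\<bar>\<^sup>2 / (4 T)) * fourier (\<lambda>y. exp (\<i> \<bar>y\<bar>\<^sup>2 / (4 T)) * f y) (x / (2 T))\<close>

  almost everywhere (\<open>schrodinger_eq_dispersive\<close>). Hence the energy of the evolved function on
  \<open>2 T B\<close> is the energy on \<open>B\<close> of the Fourier transform of the chirped function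
  (\<open>observed_energy_eq\<close>), and a chirp changes the modulus of \<open>f\<close> nowhere. So the observability
  inequality for \<open>f\<close> is the uncertainty inequality for the chirped \<open>f\<close>, with the same constant.

  The work lies in proving the formula for every square integrable \<open>f\<close>, starting from the
  definition of the Fourier transform as the closure of the Fourier integral. The tool is the
  Gaussian \<open>exp (- z \<bar>x\<bar>\<^sup>2 / 2)\<close> with complex \<open>z\<close>, whose transform is known explicitly
  (\<open>fourier_integral_gauss\<close>). Multiplying a transform by it and transforming back gives the
  convolution with another Gaussian (\<open>fourier_inverse_gauss_times_fourier\<close>). Letting \<open>z\<close> tend to
  0 along the positive reals yields Plancherel's identity (\<open>plancherel_C_c\<close>) and the inversion
  formula (\<open>fourier_inversion\<close>); letting \<open>z\<close> tend to \<open>2 \<i> T\<close> yields the formula above for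
  continuous functions of bounded support (\<open>dispersive_formula_C_c\<close>). Such functions are dense
  (\<open>C_c_dense\<close>), the space is complete (\<open>L2_complete\<close>) and the Fourier transform is a closed
  isometry (\<open>is_fourier_transform_limit\<close>, \<open>is_fourier_transform_sqnorm\<close>), which extends the
  formula to all \<open>f\<close>.
\<close>

section \<open>Gaussian integrals with complex parameter\<close>

lemma gaussian_integrable_real:
  assumes "0 < a"
  shows "integrable lborel (\<lambda>x::real. exp (- a * x\<^sup>2 / 2))"
proof -
  have "integrable lborel (\<lambda>x. sqrt (2 * pi / a) * normal_density 0 (1 / sqrt a) x)"
    using assms by (intro integrable_mult_right integrable_normal_density) auto
  also have "(\<lambda>x. sqrt (2 * pi / a) * normal_density 0 (1 / sqrt a) x) = (\<lambda>x. exp (- a * x\<^sup>2 / 2))"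
    using assms by (auto simp: normal_density_def fun_eq_iff power_divide real_sqrt_divide field_simps)
  finally show ?thesis .
qed

lemma gaussian_integrable:
  assumes "0 < Re z"
  shows "integrable lborel (\<lambda>x::real. exp (- z * complex_of_real (x\<^sup>2) / 2 - \<i> * complex_of_real (x * t)))"
proof (rule Bochner_Integration.integrable_bound[OF gaussian_integrable_real[OF assms]])
  show "AE x in lborel. norm (exp (- z * complex_of_real (x\<^sup>2) / 2 - \<i> * complex_of_real (x * t)))
      \<le> norm (exp (- Re z * x\<^sup>2 / 2))"
    by (simp add: norm_exp_eq_Re)
qed measurable

text \<open>For positive \<open>a\<close> this is the characteristic function of the standard normal
  law, after rescaling.\<close>
lemma gaussian_integral_real:
  assumes "0 < a"
  shows "(LINT x|lborel. exp (- complex_of_real a * complex_of_real (x\<^sup>2) / 2 - \<i> * complex_of_real (x * t)))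
     = complex_of_real (sqrt (2 * pi)) / csqrt (complex_of_real a) * exp (- complex_of_real (t\<^sup>2) / (2 * complex_of_real a))"
    (is "(LINT x|lborel. ?f x) = _")
proof -
  \<comment> \<open>The substitution \<open>x = s y\<close> normalises the variance.\<close>
  define s where "s = 1 / sqrt a"
  have s: "0 < s" "a * s\<^sup>2 = 1" using assms by (auto simp: s_def power_divide)
  have eq: "?f (0 + s * x) = complex_of_real (sqrt (2 * pi)) * (std_normal_density x *\<^sub>R iexp (- (s * t) * x))" for x
  proof -
    have "a * (s * x)\<^sup>2 = x\<^sup>2" using s(2) by (simp add: power_mult_distrib mult.assoc[symmetric])
    then have "complex_of_real a * complex_of_real ((s * x)\<^sup>2) = complex_of_real (x\<^sup>2)"
      by (metis of_real_mult)
    then have "- complex_of_real a * complex_of_real ((s * x)\<^sup>2) / 2 = - complex_of_real (x\<^sup>2) / 2"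
      by (simp only: mult_minus_left)
    then have "?f (0 + s * x) = exp (- complex_of_real (x\<^sup>2) / 2 - \<i> * complex_of_real (s * x * t))"
      by (simp only: add_0)
    also have "\<dots> = exp (- complex_of_real (x\<^sup>2) / 2) * iexp (- (s * t) * x)"
      unfolding exp_add[symmetric] by (rule arg_cong[of _ _ exp]) (simp add: algebra_simps)
    also have "exp (- complex_of_real (x\<^sup>2) / 2) = complex_of_real (exp (- x\<^sup>2 / 2))"
      by (simp flip: exp_of_real)
    also have "\<dots> = complex_of_real (sqrt (2 * pi)) * std_normal_density x"
      by (simp add: normal_density_def)
    finally show ?thesis by (simp add: scaleR_conv_of_real)
  qed
  have "(LINT x|lborel. ?f x) = \<bar>s\<bar> *\<^sub>R (LINT x|lborel. ?f (0 + s * x))"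
    using s by (intro lborel_integral_real_affine) auto
  also have "(LINT x|lborel. ?f (0 + s * x))
      = complex_of_real (sqrt (2 * pi)) * (LINT x|lborel. std_normal_density x *\<^sub>R iexp (- (s * t) * x))"
    unfolding eq by (rule integral_mult_right_zero)
  also have "(LINT x|lborel. std_normal_density x *\<^sub>R iexp (- (s * t) * x)) = char std_normal_distribution (- (s * t))"
    unfolding char_def by (subst integral_density) (auto simp: normal_density_nonneg)
  also have "\<dots> = exp (- complex_of_real (t\<^sup>2) / (2 * complex_of_real a))"
  proof -
    have "(s * t)\<^sup>2 = t\<^sup>2 / a"
      using assms by (simp add: s_def power_divide power_mult_distrib)
    then have "char std_normal_distribution (- (s * t)) = complex_of_real (exp (- t\<^sup>2 / (2 * a)))"
      by (simp add: char_std_normal_distribution)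
    then show ?thesis by (simp flip: exp_of_real)
  qed
  finally show ?thesis
    using s assms by (simp add: s_def scaleR_conv_of_real csqrt_of_real_nonneg field_simps)
qed

text \<open>On \<open>Re z > 0\<close> the integral is a locally uniform limit of the integrals over
  \<open>[-n, n]\<close>: on a disc where \<open>Re w \<ge> a > 0\<close> the neglected part is at
  most a tail of \<open>exp (- a x\<^sup>2 / 2)\<close>, whatever \<open>w\<close> is.\<close>
lemma gaussian_integral_holomorphic:
  fixes t :: real
  defines "f \<equiv> \<lambda>z x. exp (- z * complex_of_real (x\<^sup>2) / 2 - \<i> * complex_of_real (x * t))"
  shows "(\<lambda>z. LINT x|lborel. f z x) holomorphic_on {z. 0 < Re z}"
proof (rule holomorphic_uniform_sequence)
  define h where "h = (\<lambda>(n::nat) z. integral (cbox (- real n) (real n)) (f z))"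
  show "open {z. 0 < Re z}" by (simp add: open_halfspace_Re_gt)
  show "h n holomorphic_on {z. 0 < Re z}" for n
    unfolding h_def
  proof (rule leibniz_rule_holomorphic)
    fix z x
    show "((\<lambda>z. f z x) has_field_derivative - complex_of_real (x\<^sup>2) / 2 * f z x) (at z within {z. 0 < Re z})"
      unfolding f_def by (auto intro!: derivative_eq_intros)
    show "f z integrable_on cbox (- real n) (real n)"
      unfolding f_def by (intro integrable_continuous continuous_intros) auto
  next
    show "continuous_on ({z. 0 < Re z} \<times> cbox (- real n) (real n))
        (\<lambda>(z, x). - complex_of_real (x\<^sup>2) / 2 * f z x)"
      unfolding f_def case_prod_beta by (intro continuous_intros) auto
    show "convex {z. 0 < Re z}" by (simp add: convex_halfspace_Re_gt)
  qed
  fix z assume "z \<in> {z. 0 < Re z}"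
  then have z: "0 < Re z" by simp
  define a where "a = Re z / 2"
  have a: "0 < a" using z by (simp add: a_def)
  have Re_ge: "a \<le> Re w" if "w \<in> cball z a" for w
    using that abs_Re_le_cmod[of "z - w"] by (auto simp: a_def dist_norm)
  define \<tau> where "\<tau> = (\<lambda>n::nat. LINT x|lborel. indicator (- {- real n..real n}) x * exp (- a * x\<^sup>2 / 2))"
  have int: "integrable lborel (\<lambda>x. indicator (- {- real n..real n}) x * exp (- a * x\<^sup>2 / 2))" for n
    using integrable_mult_indicator[OF _ gaussian_integrable_real[OF a], of "- {- real n..real n}"] by simp
  have "\<tau> \<longlonglongrightarrow> (LINT x|(lborel :: real measure). 0)"
    unfolding \<tau>_def
  proof (rule integral_dominated_convergence[where w = "\<lambda>x. exp (- a * x\<^sup>2 / 2)"])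
    show "AE x in lborel. (\<lambda>n. indicator (- {- real n..real n}) x * exp (- a * x\<^sup>2 / 2)) \<longlonglongrightarrow> 0"
    proof (intro AE_I2 tendsto_eventually)
      fix x :: real
      obtain N :: nat where "\<bar>x\<bar> \<le> N" using real_arch_simple by blast
      then have "indicator (- {- real n..real n}) x * exp (- a * x\<^sup>2 / 2) = 0" if "n \<ge> N" for n
        using that by (auto simp: indicator_def)
      then show "\<forall>\<^sub>F n in sequentially. indicator (- {- real n..real n}) x * exp (- a * x\<^sup>2 / 2) = 0"
        using eventually_sequentially by blast
    qed
    show "integrable lborel (\<lambda>x. exp (- a * x\<^sup>2 / 2))"
      using gaussian_integrable_real[OF a] .
  qed (auto simp: indicator_def)
  then have \<tau>: "\<tau> \<longlonglongrightarrow> 0" by simp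
  have "uniform_limit (cball z a) h (\<lambda>z. LINT x|lborel. f z x) sequentially"
  proof (rule uniform_limitI)
    fix e :: real assume "0 < e"
    have bd: "dist (h n w) (LINT x|lborel. f w x) \<le> \<tau> n" if w: "w \<in> cball z a" for n w
    proof -
      let ?I = "{- real n..real n}"
      have fw: "integrable lborel (f w)"
        unfolding f_def using Re_ge[OF w] a by (intro gaussian_integrable) auto
      have sint: "set_integrable lborel S (f w)" if "S \<in> sets lborel" for S
        using integrable_mult_indicator[OF that fw] by (simp add: set_integrable_def)
      have "h n w = (LINT x:?I|lborel. f w x)"
        using set_borel_integral_eq_integral(2)[OF sint[of ?I]] by (simp add: h_def)
      moreover have "(LINT x|lborel. f w x) = (LINT x:?I|lborel. f w x) + (LINT x:- ?I|lborel. f w x)"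
        using set_integral_Un[OF _ sint[of ?I] sint[of "- ?I"]] by (simp add: Compl_partition set_lebesgue_integral_def)
      ultimately have "dist (h n w) (LINT x|lborel. f w x) = norm (LINT x|lborel. indicator (- ?I) x *\<^sub>R f w x)"
        by (simp add: dist_norm set_lebesgue_integral_def)
      also have "\<dots> \<le> \<tau> n"
        unfolding \<tau>_def
      proof (rule Bochner_Integration.integral_norm_bound_integral[OF _ int])
        show "integrable lborel (\<lambda>x. indicator (- ?I) x *\<^sub>R f w x)"
          using sint[of "- ?I"] by (simp add: set_integrable_def)
        show "norm (indicator (- ?I) x *\<^sub>R f w x) \<le> indicator (- ?I) x * exp (- a * x\<^sup>2 / 2)" for x
          using mult_right_mono[OF Re_ge[OF w], of "x\<^sup>2"]
          by (auto simp: f_def norm_exp_eq_Re indicator_def)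
      qed
      finally show ?thesis .
    qed
    have "\<forall>\<^sub>F n in sequentially. \<tau> n < e"
      using order_tendstoD(2)[OF \<tau> \<open>0 < e\<close>] .
    then show "\<forall>\<^sub>F n in sequentially. \<forall>w\<in>cball z a. dist (h n w) (LINT x|lborel. f w x) < e"
      by eventually_elim (use bd le_less_trans in blast)
  qed
  moreover have "cball z a \<subseteq> {z. 0 < Re z}"
    using Re_ge a by force
  ultimately show "\<exists>d>0. cball z d \<subseteq> {z. 0 < Re z}
      \<and> uniform_limit (cball z d) h (\<lambda>z. LINT x|lborel. f z x) sequentially"
    using a by blast
qed

text \<open>Both sides are holomorphic in the right half-plane and agree on the positive reals, so
  they agree throughout. The complex parameter matters: the Schroedinger multiplier is the boundary
  value, as \<open>Re z\<close> tends to 0, of such Gaussians.\<close>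
lemma gaussian_integral:
  assumes "0 < Re z"
  shows "(LINT x|lborel. exp (- z * complex_of_real (x\<^sup>2) / 2 - \<i> * complex_of_real (x * t)))
     = complex_of_real (sqrt (2 * pi)) / csqrt z * exp (- complex_of_real (t\<^sup>2) / (2 * z))"
    (is "?L z = ?R z")
proof -
  have "?L z - ?R z = 0"
  proof (rule analytic_continuation[where S = "{z. 0 < Re z}" and U = "complex_of_real ` {0<..}" and \<xi> = 1
        and f = "\<lambda>z. ?L z - ?R z"])
    show "(\<lambda>z. ?L z - ?R z) holomorphic_on {z. 0 < Re z}"
      by (intro holomorphic_intros gaussian_integral_holomorphic) (auto simp: complex_nonpos_Reals_iff)
    show "connected {z. 0 < Re z}"
      by (simp add: convex_connected convex_halfspace_Re_gt)
    show "1 islimpt complex_of_real ` {0<..}"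
      unfolding islimpt_approachable
    proof (intro allI impI)
      fix e :: real assume "0 < e"
      then show "\<exists>x'\<in>complex_of_real ` {0<..}. x' \<noteq> 1 \<and> dist x' 1 < e"
        by (intro bexI[of _ "complex_of_real (1 + e / 2)"]) (auto simp: dist_norm intro!: image_eqI[of _ _ "1 + e / 2"])
    qed
    show "?L w - ?R w = 0" if "w \<in> complex_of_real ` {0<..}" for w
      using that gaussian_integral_real by auto
  qed (use assms in \<open>auto simp: open_halfspace_Re_gt\<close>)
  then show ?thesis by simp
qed

text \<open>Lebesgue measure is the product measure in the coordinates, so integrals of tensor
  products factorise; this carries the one-dimensional Gaussian integral to all dimensions.\<close>
lemma lborel_integral_prod:
  fixes g :: "'a::euclidean_space \<Rightarrow> real \<Rightarrow> complex"
  assumes g: "\<And>b. b \<in> Basis \<Longrightarrow> integrable lborel (g b)"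
  shows "integrable lborel (\<lambda>x::'a. \<Prod>b\<in>Basis. g b (x \<bullet> b))"
    and "(LINT x|lborel. (\<Prod>b\<in>Basis. g b (x \<bullet> b))) = (\<Prod>b\<in>(Basis::'a set). LINT s|lborel. g b s)"
proof -
  interpret product_sigma_finite "\<lambda>_::'a. lborel :: real measure"
    by standard
  have lb: "(lborel :: 'a measure) = distr (\<Pi>\<^sub>M b\<in>Basis. lborel) borel (\<lambda>f. \<Sum>b\<in>Basis. f b *\<^sub>R b)"
    by (subst lborel_def) (simp add: lborel_eq_real)
  note [measurable] = borel_measurable_integrable[OF g]
  have coord: "(\<Sum>c\<in>Basis. f c *\<^sub>R c) \<bullet> b = f b" if "b \<in> Basis" for f and b :: 'a
    using that by (simp add: inner_sum_left inner_Basis if_distrib cong: if_cong)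
  have eq: "(\<Prod>b\<in>Basis. g b ((\<Sum>c\<in>Basis. f c *\<^sub>R c) \<bullet> b)) = (\<Prod>b\<in>Basis. g b (f b))" for f
    by (intro prod.cong refl) (simp add: coord)
  show "integrable lborel (\<lambda>x::'a. \<Prod>b\<in>Basis. g b (x \<bullet> b))"
    by (subst lb, subst integrable_distr_eq) (auto simp: eq intro!: product_integrable_prod g)
  show "(LINT x|lborel. (\<Prod>b\<in>Basis. g b (x \<bullet> b))) = (\<Prod>b\<in>(Basis::'a set). LINT s|lborel. g b s)"
    by (subst lb, subst integral_distr) (auto simp: eq intro!: product_integral_prod g)
qed


definition gauss :: "complex \<Rightarrow> 'a::real_normed_vector \<Rightarrow> complex" where
  "gauss z x = exp (- z * complex_of_real ((norm x)\<^sup>2) / 2)"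

lemma gauss_continuous [continuous_intros]: "continuous_on S (gauss z)"
  unfolding gauss_def by (intro continuous_intros) auto

lemma gauss_measurable [measurable]: "gauss z \<in> borel_measurable borel"
  by (intro borel_measurable_continuous_onI continuous_intros)

lemma continuous_measurable_lebesgue:
  fixes f :: "'a::euclidean_space \<Rightarrow> 'b::{metric_space,topological_space}"
  shows "continuous_on UNIV f \<Longrightarrow> f \<in> borel_measurable lebesgue"
  by (intro measurable_completion) (simp add: borel_measurable_continuous_onI)

lemma id_measurable_lebesgue:
  "(\<lambda>x :: 'a::euclidean_space. x) \<in> borel_measurable lebesgue"
  by (intro continuous_measurable_lebesgue continuous_intros)

lemma integrable_lebesgue_of_lborel: "integrable lborel f \<Longrightarrow> integrable lebesgue f"
  for f :: "'a::euclidean_space \<Rightarrow> complex"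
  using integrable_completion borel_measurable_integrable by blast

lemma norm_gauss: "cmod (gauss z x) = exp (- Re z * (norm x)\<^sup>2 / 2)"
  by (simp add: gauss_def norm_exp_eq_Re)

lemma norm_gauss_le: "0 \<le> Re z \<Longrightarrow> cmod (gauss z x) \<le> 1"
  by (simp add: norm_gauss)

lemma gauss_exp_prod:
  fixes x \<xi> :: "'a::euclidean_space"
  shows "gauss z x * exp (- \<i> * complex_of_real (x \<bullet> \<xi>)) =
    (\<Prod>b\<in>Basis. exp (- z * complex_of_real ((x \<bullet> b)\<^sup>2) / 2 - \<i> * complex_of_real ((x \<bullet> b) * (\<xi> \<bullet> b))))"
proof -
  have n: "(norm x)\<^sup>2 = (\<Sum>b\<in>Basis. (x \<bullet> b)\<^sup>2)"
    unfolding power2_norm_eq_inner by (subst euclidean_inner) (simp add: power2_eq_square)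
  have i: "x \<bullet> \<xi> = (\<Sum>b\<in>Basis. (x \<bullet> b) * (\<xi> \<bullet> b))"
    by (rule euclidean_inner)
  have "- z * complex_of_real ((norm x)\<^sup>2) / 2 - \<i> * complex_of_real (x \<bullet> \<xi>) =
    (\<Sum>b\<in>Basis. - z * complex_of_real ((x \<bullet> b)\<^sup>2) / 2 - \<i> * complex_of_real ((x \<bullet> b) * (\<xi> \<bullet> b)))"
    unfolding n i by (simp only: of_real_sum sum_distrib_left sum_divide_distrib sum_subtractf)
  then have "exp (- z * complex_of_real ((norm x)\<^sup>2) / 2 - \<i> * complex_of_real (x \<bullet> \<xi>)) =
    (\<Prod>b\<in>Basis. exp (- z * complex_of_real ((x \<bullet> b)\<^sup>2) / 2 - \<i> * complex_of_real ((x \<bullet> b) * (\<xi> \<bullet> b))))"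
    by (simp only: exp_sum finite_Basis)
  then show ?thesis
    by (simp add: gauss_def exp_add[symmetric])
qed

lemma gauss_integrable:
  assumes "0 < Re z"
  shows "integrable lborel (gauss z :: 'a::euclidean_space \<Rightarrow> complex)"
  using lborel_integral_prod(1)[of "\<lambda>b s. exp (- z * complex_of_real (s\<^sup>2) / 2 - \<i> * complex_of_real (s * ((0::'a) \<bullet> b)))",
      OF gaussian_integrable[OF assms]]
  unfolding gauss_exp_prod[symmetric] by simp

lemma gauss_integral:
  fixes \<xi> :: "'a::euclidean_space"
  assumes "0 < Re z"
  shows "(LINT x|lborel. gauss z x * exp (- \<i> * complex_of_real (x \<bullet> \<xi>)))
    = (complex_of_real (sqrt (2 * pi)) / csqrt z) ^ DIM('a) * gauss (1 / z) \<xi>"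
proof -
  have n: "(norm \<xi>)\<^sup>2 = (\<Sum>b\<in>Basis. (\<xi> \<bullet> b)\<^sup>2)"
    unfolding power2_norm_eq_inner by (subst euclidean_inner) (simp add: power2_eq_square)
  have "(LINT x|lborel. gauss z x * exp (- \<i> * complex_of_real (x \<bullet> \<xi>)))
     = (\<Prod>b\<in>(Basis::'a set). complex_of_real (sqrt (2 * pi)) / csqrt z * exp (- complex_of_real ((\<xi> \<bullet> b)\<^sup>2) / (2 * z)))"
    unfolding gauss_exp_prod
    by (subst lborel_integral_prod(2)[of "\<lambda>b s. exp (- z * complex_of_real (s\<^sup>2) / 2 - \<i> * complex_of_real (s * (\<xi> \<bullet> b)))"])
       (simp_all only: gaussian_integrable[OF assms] gaussian_integral[OF assms])
  also have "\<dots> = (complex_of_real (sqrt (2 * pi)) / csqrt z) ^ DIM('a)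
      * exp (\<Sum>b\<in>(Basis::'a set). - complex_of_real ((\<xi> \<bullet> b)\<^sup>2) / (2 * z))"
    by (simp only: prod.distrib prod_constant exp_sum finite_Basis)
  also have "(\<Sum>b\<in>(Basis::'a set). - complex_of_real ((\<xi> \<bullet> b)\<^sup>2) / (2 * z))
      = - (1 / z) * complex_of_real ((norm \<xi>)\<^sup>2) / 2"
    unfolding n by (simp add: sum_divide_distrib sum_negf mult.commute)
  finally show ?thesis
    by (simp only: gauss_def)
qed

lemma fourier_integral_lborel:
  fixes f :: "real ^ 'n \<Rightarrow> complex"
  assumes [measurable]: "f \<in> borel_measurable borel"
  shows "fourier_integral f \<xi> = complex_of_real ((2 * pi) powr (- real CARD('n) / 2)) *
     (LINT x|lborel. f x * exp (- \<i> * complex_of_real (x \<bullet> \<xi>)))"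
  unfolding fourier_integral_def by (subst integral_completion) auto

text \<open>The factor \<open>(1 / csqrt z) ^ n\<close> is the branch of \<open>z\<close> to the
  power \<open>- n / 2\<close> that is positive for positive \<open>z\<close>; it stays continuous
  up to the imaginary axis without 0.\<close>
lemma fourier_integral_gauss:
  fixes \<xi> :: "real ^ 'n"
  assumes "0 < Re z"
  shows "fourier_integral (gauss z) \<xi> = (1 / csqrt z) ^ CARD('n) * gauss (1 / z) \<xi>"
proof -
  have "(2 * pi) powr (- real CARD('n) / 2) * sqrt (2 * pi) ^ CARD('n) = 1"
    by (simp add: powr_half_sqrt[symmetric] powr_realpow[symmetric] powr_powr powr_add[symmetric])
  then have c: "complex_of_real ((2 * pi) powr (- real CARD('n) / 2)) * complex_of_real (sqrt (2 * pi)) ^ CARD('n) = 1"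
    by (metis of_real_1 of_real_mult of_real_power)
  show ?thesis
    unfolding fourier_integral_lborel[OF gauss_measurable] gauss_integral[OF assms] power_divide
    using c by simp
qed

section \<open>The space of square integrable functions\<close>

text \<open>The squared norm takes extended values, so that it is monotone and obeys Fatou's lemma
  for all measurable functions.\<close>
definition sqnorm :: "(real ^ 'n \<Rightarrow> complex) \<Rightarrow> ennreal" where
  "sqnorm f = (\<integral>\<^sup>+ x. ennreal ((cmod (f x))\<^sup>2) \<partial>lebesgue)"

lemma square_integrable_iff:
  "square_integrable f \<longleftrightarrow> f \<in> borel_measurable lebesgue \<and> sqnorm f < \<infinity>"
  by (auto simp: square_integrable_def sqnorm_def integrable_iff_bounded)

lemma square_integrable_measurable [measurable_dest]:
  "square_integrable f \<Longrightarrow> f \<in> borel_measurable lebesgue"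
  by (simp add: square_integrable_def)

lemma sqnorm_mono:
  assumes "\<And>x. cmod (f x) \<le> cmod (g x)"
  shows "sqnorm f \<le> sqnorm g"
  unfolding sqnorm_def by (intro nn_integral_mono ennreal_leI power_mono assms) auto

lemma sqnorm_cong_AE:
  assumes "AE x in lebesgue. f x = g x"
  shows "sqnorm f = sqnorm g"
  unfolding sqnorm_def using assms by (intro nn_integral_cong_AE) auto

lemma sqnorm_commute: "sqnorm (\<lambda>x. f x - g x) = sqnorm (\<lambda>x. g x - f x)"
  by (simp add: sqnorm_def norm_minus_commute)

lemma sqnorm_eq_0:
  assumes [measurable]: "f \<in> borel_measurable lebesgue" and "sqnorm f = 0"
  shows "AE x in lebesgue. f x = 0"
  using assms(2) unfolding sqnorm_def by (subst (asm) nn_integral_0_iff_AE) auto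

lemma sqnorm_scale:
  assumes "f \<in> borel_measurable lebesgue"
  shows "sqnorm (\<lambda>x. c * f x) = ennreal ((cmod c)\<^sup>2) * sqnorm f"
  using assms unfolding sqnorm_def norm_mult power_mult_distrib
  by (subst ennreal_mult) (auto intro!: nn_integral_cmult)

text \<open>Expand the square and use \<open>2 a b \<le> \<delta> a\<^sup>2 + b\<^sup>2 /
  \<delta>\<close>. Letting \<open>\<delta>\<close> tend to 0 after the second summand has become
  small replaces Minkowski's inequality, and avoids square roots of extended numbers.\<close>
lemma sqnorm_add_le_weighted:
  assumes [measurable]: "f \<in> borel_measurable lebesgue" "g \<in> borel_measurable lebesgue"
    and \<delta>: "0 < \<delta>"
  shows "sqnorm (\<lambda>x. f x + g x) \<le> ennreal (1 + \<delta>) * sqnorm f + ennreal (1 + 1 / \<delta>) * sqnorm g"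
proof -
  have le: "ennreal ((cmod (a + b))\<^sup>2)
      \<le> ennreal (1 + \<delta>) * ennreal ((cmod a)\<^sup>2) + ennreal (1 + 1 / \<delta>) * ennreal ((cmod b)\<^sup>2)" for a b
  proof -
    have "(cmod (a + b))\<^sup>2 \<le> (cmod a + cmod b)\<^sup>2"
      by (intro power_mono norm_triangle_ineq) auto
    also have "\<dots> \<le> (cmod a + cmod b)\<^sup>2 + (\<delta> * cmod a - cmod b)\<^sup>2 / \<delta>"
      using \<delta> by simp
    also have "\<dots> = (1 + \<delta>) * (cmod a)\<^sup>2 + (1 + 1 / \<delta>) * (cmod b)\<^sup>2"
      using \<delta> by (simp add: power2_eq_square field_simps)
    finally have "ennreal ((cmod (a + b))\<^sup>2) \<le> ennreal ((1 + \<delta>) * (cmod a)\<^sup>2 + (1 + 1 / \<delta>) * (cmod b)\<^sup>2)"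
      by (rule ennreal_leI)
    also have "\<dots> = ennreal (1 + \<delta>) * ennreal ((cmod a)\<^sup>2) + ennreal (1 + 1 / \<delta>) * ennreal ((cmod b)\<^sup>2)"
      using \<delta> by (subst ennreal_plus) (auto simp: ennreal_mult simp del: ennreal_plus)
    finally show ?thesis .
  qed
  have "sqnorm (\<lambda>x. f x + g x)
      \<le> (\<integral>\<^sup>+ x. ennreal (1 + \<delta>) * ennreal ((cmod (f x))\<^sup>2) + ennreal (1 + 1 / \<delta>) * ennreal ((cmod (g x))\<^sup>2) \<partial>lebesgue)"
    unfolding sqnorm_def by (intro nn_integral_mono le)
  also have "\<dots> = ennreal (1 + \<delta>) * sqnorm f + ennreal (1 + 1 / \<delta>) * sqnorm g"
    unfolding sqnorm_def by (subst nn_integral_add) (auto simp: nn_integral_cmult simp del: ennreal_plus)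
  finally show ?thesis .
qed

lemma sqnorm_add_le:
  assumes "f \<in> borel_measurable lebesgue" "g \<in> borel_measurable lebesgue"
  shows "sqnorm (\<lambda>x. f x + g x) \<le> 2 * sqnorm f + 2 * sqnorm g"
  using sqnorm_add_le_weighted[OF assms, of 1] by (simp add: one_add_one)

lemma sqnorm_diff_le:
  assumes [measurable]: "f \<in> borel_measurable lebesgue" "g \<in> borel_measurable lebesgue"
    "h \<in> borel_measurable lebesgue"
  shows "sqnorm (\<lambda>x. f x - h x) \<le> 2 * sqnorm (\<lambda>x. f x - g x) + 2 * sqnorm (\<lambda>x. g x - h x)"
  using sqnorm_add_le[of "\<lambda>x. f x - g x" "\<lambda>x. g x - h x"] by simp

lemma square_integrable_diff:
  assumes "square_integrable f" "square_integrable g"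
  shows "square_integrable (\<lambda>x. f x - g x)"
proof -
  note [measurable] = assms[THEN square_integrable_measurable]
  have "sqnorm (\<lambda>x. f x - g x) \<le> 2 * sqnorm f + 2 * sqnorm (\<lambda>x. - g x)"
    using sqnorm_add_le[of f "\<lambda>x. - g x"] by simp
  also have "sqnorm (\<lambda>x. - g x) = sqnorm g"
    by (simp add: sqnorm_def)
  finally show ?thesis
    using assms by (auto simp: square_integrable_iff ennreal_mult_less_top le_less_trans)
qed

lemma square_integrable_bounded_mult:
  assumes "square_integrable f" and [measurable]: "m \<in> borel_measurable lebesgue"
    and "\<And>x. cmod (m x) \<le> C"
  shows "square_integrable (\<lambda>x. m x * f x)"
proof -
  note [measurable] = assms(1)[THEN square_integrable_measurable]
  have "0 \<le> C" using assms(3)[of undefined] norm_ge_zero order_trans by blast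
  have "sqnorm (\<lambda>x. m x * f x) \<le> sqnorm (\<lambda>x. of_real C * f x)"
    by (rule sqnorm_mono) (use assms(3) \<open>0 \<le> C\<close> in \<open>auto simp: norm_mult intro!: mult_right_mono\<close>)
  also have "\<dots> = ennreal (C\<^sup>2) * sqnorm f"
    by (subst sqnorm_scale) auto
  finally show ?thesis
    using assms(1) by (auto simp: square_integrable_iff ennreal_mult_less_top le_less_trans)
qed

lemma L2_tendsto_iff: "L2_tendsto F f \<longleftrightarrow> (\<lambda>k. sqnorm (\<lambda>x. F k x - f x)) \<longlonglongrightarrow> 0"
  by (simp add: L2_tendsto_def sqnorm_def)

lemma ennreal_tendsto_0_le:
  fixes f g :: "'a \<Rightarrow> ennreal"
  assumes "(g \<longlongrightarrow> 0) G" "\<And>x. f x \<le> c * g x" "c < \<infinity>"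
  shows "(f \<longlongrightarrow> 0) G"
proof (rule tendsto_sandwich[of "\<lambda>_. 0" _ _ "\<lambda>x. c * g x"])
  show "((\<lambda>x. c * g x) \<longlongrightarrow> 0) G"
    using ennreal_tendsto_cmult[OF _ assms(1), of c] assms(3) by simp
qed (use assms in auto)

lemma L2_tendsto_dominated:
  assumes [measurable]: "\<And>k. F k \<in> borel_measurable lebesgue" "f \<in> borel_measurable lebesgue"
    and lim: "AE x in lebesgue. (\<lambda>k. F k x) \<longlonglongrightarrow> f x"
    and "square_integrable g" and bd: "\<And>k x. cmod (F k x) \<le> cmod (g x)"
  shows "L2_tendsto F f"
proof -
  note [measurable] = assms(4)[THEN square_integrable_measurable]
  have "(\<lambda>k. \<integral>\<^sup>+ x. ennreal ((cmod (F k x - f x))\<^sup>2) \<partial>lebesgue) \<longlonglongrightarrow> (\<integral>\<^sup>+ x. 0 \<partial>(lebesgue :: (real^'a) measure))"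
  proof (rule nn_integral_dominated_convergence[where w = "\<lambda>x. 4 * ennreal ((cmod (g x))\<^sup>2)"])
    show "AE x in lebesgue. ennreal ((cmod (F j x - f x))\<^sup>2) \<le> 4 * ennreal ((cmod (g x))\<^sup>2)" for j
      using lim
    proof eventually_elim
      case (elim x)
      have "cmod (f x) \<le> cmod (g x)"
        using tendsto_norm[OF elim] bd by (intro LIMSEQ_le_const2) auto
      then have "cmod (F j x - f x) \<le> 2 * cmod (g x)"
        using bd[of j x] norm_triangle_ineq4[of "F j x" "f x"] by linarith
      then have "(cmod (F j x - f x))\<^sup>2 \<le> (2 * cmod (g x))\<^sup>2"
        by (intro power_mono) auto
      then have "ennreal ((cmod (F j x - f x))\<^sup>2) \<le> ennreal (4 * (cmod (g x))\<^sup>2)"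
        by (intro ennreal_leI) (simp add: power_mult_distrib)
      then show ?case by (simp add: ennreal_mult)
    qed
    show "(\<integral>\<^sup>+ x. 4 * ennreal ((cmod (g x))\<^sup>2) \<partial>lebesgue) < \<infinity>"
      using assms(4) unfolding square_integrable_iff sqnorm_def
      by (subst nn_integral_cmult) (auto simp: ennreal_mult_less_top)
    show "AE x in lebesgue. (\<lambda>k. ennreal ((cmod (F k x - f x))\<^sup>2)) \<longlonglongrightarrow> 0"
      using lim
    proof eventually_elim
      case (elim x)
      then have "(\<lambda>k. (cmod (F k x - f x))\<^sup>2) \<longlonglongrightarrow> (cmod (f x - f x))\<^sup>2"
        by (intro tendsto_intros)
      then show ?case
        using tendsto_ennrealI by fastforce
    qed
  qed auto
  then show ?thesis by (simp add: L2_tendsto_def)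
qed

text \<open>Cauchy sequences as a limit along a product filter, so that bounds between two sequences
  transfer by squeezing.\<close>
definition L2_Cauchy :: "(nat \<Rightarrow> real ^ 'n \<Rightarrow> complex) \<Rightarrow> bool" where
  "L2_Cauchy F \<longleftrightarrow>
     ((\<lambda>(j, k). sqnorm (\<lambda>x. F j x - F k x)) \<longlongrightarrow> 0) (sequentially \<times>\<^sub>F sequentially)"

lemma L2_tendsto_imp_Cauchy:
  assumes [measurable]: "\<And>k. F k \<in> borel_measurable lebesgue" "f \<in> borel_measurable lebesgue"
    and "L2_tendsto F f"
  shows "L2_Cauchy F"
  unfolding L2_Cauchy_def
proof (rule tendsto_sandwich[of "\<lambda>_. 0"])
  let ?n = "\<lambda>k. sqnorm (\<lambda>x. F k x - f x)"
  show "\<forall>\<^sub>F p in sequentially \<times>\<^sub>F sequentially. (case p of (j, k) \<Rightarrow> sqnorm (\<lambda>x. F j x - F k x))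
      \<le> 2 * ?n (fst p) + 2 * ?n (snd p)"
    using sqnorm_diff_le[of "F _" f "F _"]
    by (intro always_eventually) (auto simp: sqnorm_commute[of f])
  have "((\<lambda>p. ?n (fst p)) \<longlongrightarrow> 0) (sequentially \<times>\<^sub>F sequentially)"
    "((\<lambda>p. ?n (snd p)) \<longlongrightarrow> 0) (sequentially \<times>\<^sub>F sequentially)"
    by (rule filterlim_compose[OF assms(3)[unfolded L2_tendsto_iff]], rule filterlim_fst filterlim_snd)+
  from tendsto_add[OF ennreal_tendsto_cmult[OF _ this(1), of 2] ennreal_tendsto_cmult[OF _ this(2), of 2]]
  show "((\<lambda>p. 2 * ?n (fst p) + 2 * ?n (snd p)) \<longlongrightarrow> 0) (sequentially \<times>\<^sub>F sequentially)"
    by simp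
qed auto

lemma L2_CauchyD:
  assumes "L2_Cauchy F" "0 < e"
  shows "\<exists>K. \<forall>j\<ge>K. \<forall>k\<ge>K. sqnorm (\<lambda>x. F j x - F k x) < e"
proof -
  have "\<forall>\<^sub>F p in sequentially \<times>\<^sub>F sequentially. (case p of (j, k) \<Rightarrow> sqnorm (\<lambda>x. F j x - F k x)) < e"
    using assms order_tendstoD(2) unfolding L2_Cauchy_def by blast
  then show ?thesis
    unfolding eventually_prod_sequentially by auto
qed

lemma L2_Cauchy_mono:
  assumes "L2_Cauchy F" "\<And>j k. sqnorm (\<lambda>x. G j x - G k x) \<le> c * sqnorm (\<lambda>x. F j x - F k x)" "c < \<infinity>"
  shows "L2_Cauchy G"
  unfolding L2_Cauchy_def
  by (rule ennreal_tendsto_0_le[OF assms(1)[unfolded L2_Cauchy_def] _ assms(3)])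
     (use assms(2) in auto)

text \<open>Fatou's lemma applied to \<open>F j - F (r k)\<close> as \<open>k\<close> grows. This is
  how a pointwise limit is recognised as the limit in the mean square.\<close>
lemma L2_Cauchy_pointwise:
  assumes [measurable]: "\<And>k. F k \<in> borel_measurable lebesgue" "f \<in> borel_measurable lebesgue"
    and cauchy: "L2_Cauchy F" and "strict_mono r"
    and lim: "AE x in lebesgue. (\<lambda>k. F (r k) x) \<longlonglongrightarrow> f x"
  shows "L2_tendsto F f"
  unfolding L2_tendsto_iff
proof (rule order_tendstoI)
  fix e :: ennreal assume "0 < e"
  then obtain d where d: "0 < d" "d < e" using dense by blast
  from L2_CauchyD[OF cauchy \<open>0 < d\<close>]
  obtain K where K: "\<And>j k. j \<ge> K \<Longrightarrow> k \<ge> K \<Longrightarrow> sqnorm (\<lambda>x. F j x - F k x) < d"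
    by blast
  have "sqnorm (\<lambda>x. F j x - f x) < e" if "j \<ge> K" for j
  proof -
    have "sqnorm (\<lambda>x. F j x - f x)
        = (\<integral>\<^sup>+ x. liminf (\<lambda>k. ennreal ((cmod (F j x - F (r k) x))\<^sup>2)) \<partial>lebesgue)"
      unfolding sqnorm_def
    proof (rule nn_integral_cong_AE, use lim in eventually_elim)
      case (elim x)
      then have "(\<lambda>k. ennreal ((cmod (F j x - F (r k) x))\<^sup>2)) \<longlonglongrightarrow> ennreal ((cmod (F j x - f x))\<^sup>2)"
        by (intro tendsto_intros)
      then show ?case by (rule lim_imp_Liminf[OF trivial_limit_sequentially, symmetric])
    qed
    also have "\<dots> \<le> liminf (\<lambda>k. sqnorm (\<lambda>x. F j x - F (r k) x))"
      unfolding sqnorm_def by (intro nn_integral_liminf) measurable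
    also have "\<dots> \<le> d"
    proof (rule Liminf_le)
      have "\<forall>\<^sub>F k in sequentially. r k \<ge> K"
        using filterlim_subseq[OF \<open>strict_mono r\<close>] unfolding filterlim_at_top by blast
      then show "\<forall>\<^sub>F k in sequentially. sqnorm (\<lambda>x. F j x - F (r k) x) \<le> d"
        by eventually_elim (use K that in \<open>auto intro: less_imp_le\<close>)
    qed simp
    finally show ?thesis using d by simp
  qed
  then show "\<forall>\<^sub>F j in sequentially. sqnorm (\<lambda>x. F j x - f x) < e"
    using eventually_sequentially by blast
qed auto

lemma L2_tendsto_square_integrable:
  assumes "\<And>k. square_integrable (F k)" "f \<in> borel_measurable lebesgue" "L2_tendsto F f"
  shows "square_integrable f"
proof -
  have "\<forall>\<^sub>F k in sequentially. sqnorm (\<lambda>x. F k x - f x) < 1"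
    using order_tendstoD(2)[OF assms(3)[unfolded L2_tendsto_iff], of 1] by simp
  then obtain k where "sqnorm (\<lambda>x. F k x - f x) < 1"
    by (auto simp: eventually_sequentially)
  then have "square_integrable (\<lambda>x. F k x - f x)"
    using assms(2) square_integrable_measurable[OF assms(1)[of k]]
    by (auto simp: square_integrable_iff intro: less_le_trans)
  from square_integrable_diff[OF assms(1)[of k] this] show ?thesis by simp
qed


lemma L2_tendsto_diff:
  assumes [measurable]: "\<And>k. F k \<in> borel_measurable lebesgue" "\<And>k. G k \<in> borel_measurable lebesgue"
    "f \<in> borel_measurable lebesgue" "g \<in> borel_measurable lebesgue"
    and F: "L2_tendsto F f" and G: "L2_tendsto G g"
  shows "L2_tendsto (\<lambda>k x. F k x - G k x) (\<lambda>x. f x - g x)"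
  unfolding L2_tendsto_iff
proof (rule tendsto_sandwich[of "\<lambda>_. 0"])
  show "\<forall>\<^sub>F k in sequentially. sqnorm (\<lambda>x. (F k x - G k x) - (f x - g x))
      \<le> 2 * sqnorm (\<lambda>x. F k x - f x) + 2 * sqnorm (\<lambda>x. G k x - g x)"
  proof (intro always_eventually allI)
    fix k
    show "sqnorm (\<lambda>x. (F k x - G k x) - (f x - g x))
      \<le> 2 * sqnorm (\<lambda>x. F k x - f x) + 2 * sqnorm (\<lambda>x. G k x - g x)"
      using sqnorm_add_le[of "\<lambda>x. F k x - f x" "\<lambda>x. g x - G k x"]
      by (simp add: sqnorm_commute[of g] algebra_simps)
  qed
  show "(\<lambda>k. 2 * sqnorm (\<lambda>x. F k x - f x) + 2 * sqnorm (\<lambda>x. G k x - g x)) \<longlonglongrightarrow> 0"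
    using tendsto_add[OF ennreal_tendsto_cmult[OF _ F[unfolded L2_tendsto_iff], of 2]
      ennreal_tendsto_cmult[OF _ G[unfolded L2_tendsto_iff], of 2]] by simp
qed auto

text \<open>For diagonal sequences: replacing each \<open>F k\<close> by a close enough \<open>H
  k\<close> does not change the limit.\<close>
lemma L2_tendsto_diagonal:
  assumes [measurable]: "\<And>k. F k \<in> borel_measurable lebesgue" "\<And>k. H k \<in> borel_measurable lebesgue"
    "f \<in> borel_measurable lebesgue"
    and F: "L2_tendsto F f" and H: "\<And>k. sqnorm (\<lambda>x. H k x - F k x) < ennreal (inverse (real (Suc k)))"
  shows "L2_tendsto H f"
  unfolding L2_tendsto_iff
proof (rule tendsto_sandwich[of "\<lambda>_. 0"])
  show "\<forall>\<^sub>F k in sequentially. sqnorm (\<lambda>x. H k x - f x)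
      \<le> 2 * ennreal (inverse (real (Suc k))) + 2 * sqnorm (\<lambda>x. F k x - f x)"
  proof (intro always_eventually allI)
    fix k
    have "sqnorm (\<lambda>x. H k x - f x) \<le> 2 * sqnorm (\<lambda>x. H k x - F k x) + 2 * sqnorm (\<lambda>x. F k x - f x)"
      by (rule sqnorm_diff_le) auto
    also have "\<dots> \<le> 2 * ennreal (inverse (real (Suc k))) + 2 * sqnorm (\<lambda>x. F k x - f x)"
      by (intro add_right_mono mult_left_mono less_imp_le[OF H]) auto
    finally show "sqnorm (\<lambda>x. H k x - f x)
        \<le> 2 * ennreal (inverse (real (Suc k))) + 2 * sqnorm (\<lambda>x. F k x - f x)" .
  qed
  have "(\<lambda>k. ennreal (inverse (real (Suc k)))) \<longlonglongrightarrow> 0"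
    using tendsto_ennrealI[OF LIMSEQ_inverse_real_of_nat] by simp
  from tendsto_add[OF ennreal_tendsto_cmult[OF _ this, of 2]
      ennreal_tendsto_cmult[OF _ F[unfolded L2_tendsto_iff], of 2]]
  show "(\<lambda>k. 2 * ennreal (inverse (real (Suc k))) + 2 * sqnorm (\<lambda>x. F k x - f x)) \<longlonglongrightarrow> 0"
    by simp
qed auto

text \<open>The comparison survives the limit because \<open>sqnorm g\<close> is at most \<open>(1 +
  \<delta>)\<^sup>2\<close> times \<open>sqnorm f\<close> plus terms that tend to 0, for every
  \<open>\<delta> > 0\<close>.\<close>
lemma sqnorm_le_limit:
  assumes F: "\<And>k. F k \<in> borel_measurable lebesgue" and G: "\<And>k. G k \<in> borel_measurable lebesgue"
    and f: "f \<in> borel_measurable lebesgue" and g: "g \<in> borel_measurable lebesgue"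
    and Ff: "L2_tendsto F f" and Gg: "L2_tendsto G g"
    and le: "\<And>k. sqnorm (G k) \<le> sqnorm (F k)"
  shows "sqnorm g \<le> sqnorm f"
proof (cases "sqnorm f = \<infinity>")
  case False
  have *: "sqnorm g \<le> ennreal ((1 + \<delta>)\<^sup>2) * sqnorm f" if \<delta>: "0 < \<delta>" for \<delta>
  proof -
    let ?a = "ennreal (1 + \<delta>)" and ?b = "ennreal (1 + 1 / \<delta>)"
    let ?c = "\<lambda>k. sqnorm (\<lambda>x. G k x - g x)" and ?d = "\<lambda>k. sqnorm (\<lambda>x. F k x - f x)"
    have "sqnorm g \<le> ?a * (?a * sqnorm f + ?b * ?d k) + ?b * ?c k" for k
    proof -
      have "sqnorm g \<le> ?a * sqnorm (G k) + ?b * ?c k"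
        using sqnorm_add_le_weighted[OF G[of k] borel_measurable_diff[OF g G[of k]] \<delta>]
        by (simp add: sqnorm_commute[of g] del: ennreal_plus)
      also have "sqnorm (G k) \<le> sqnorm (F k)" by (rule le)
      also have "sqnorm (F k) \<le> ?a * sqnorm f + ?b * ?d k"
        using sqnorm_add_le_weighted[OF f borel_measurable_diff[OF F[of k] f] \<delta>]
        by (simp del: ennreal_plus)
      finally show ?thesis by (simp add: mult_left_mono add_right_mono del: ennreal_plus)
    qed
    moreover have "(\<lambda>k. ?a * (?a * sqnorm f + ?b * ?d k) + ?b * ?c k) \<longlonglongrightarrow> ?a * (?a * sqnorm f + ?b * 0) + ?b * 0"
      using Ff Gg unfolding L2_tendsto_iff
      by (intro tendsto_add ennreal_tendsto_cmult tendsto_const) auto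
    ultimately have "sqnorm g \<le> ?a * (?a * sqnorm f + ?b * 0) + ?b * 0"
      by (intro LIMSEQ_le_const) auto
    also have "\<dots> = ennreal ((1 + \<delta>)\<^sup>2) * sqnorm f"
      using \<delta> by (simp add: power2_eq_square ennreal_mult mult.assoc del: ennreal_plus)
    finally show ?thesis .
  qed
  obtain r where r: "0 \<le> r" "sqnorm f = ennreal r"
    using False by (cases "sqnorm f") auto
  have "(\<lambda>k. ennreal ((1 + inverse (real (Suc k)))\<^sup>2 * r)) \<longlonglongrightarrow> ennreal ((1 + 0)\<^sup>2 * r)"
    by (intro tendsto_intros LIMSEQ_inverse_real_of_nat)
  moreover have "sqnorm g \<le> ennreal ((1 + inverse (real (Suc k)))\<^sup>2 * r)" for k
    using *[of "inverse (real (Suc k))"] r by (simp add: ennreal_mult del: of_nat_Suc)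
  ultimately have "sqnorm g \<le> ennreal ((1 + 0)\<^sup>2 * r)"
    by (intro LIMSEQ_le_const) auto
  then show ?thesis using r by simp
qed simp

lemma sqnorm_eq_limit:
  assumes "\<And>k. F k \<in> borel_measurable lebesgue" "\<And>k. G k \<in> borel_measurable lebesgue"
    "f \<in> borel_measurable lebesgue" "g \<in> borel_measurable lebesgue"
    "L2_tendsto F f" "L2_tendsto G g" "\<And>k. sqnorm (G k) = sqnorm (F k)"
  shows "sqnorm g = sqnorm f"
  using assms by (intro antisym sqnorm_le_limit[of F G f g] sqnorm_le_limit[of G F g f]) auto

text \<open>Riesz and Fischer. Multiplied by a Gaussian, a Cauchy sequence in the mean square
  becomes one in the mean, so a subsequence converges almost everywhere; as the Gaussian has no
  zeros, it can be divided out again.\<close>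
lemma L2_complete:
  fixes F :: "nat \<Rightarrow> real ^ 'n \<Rightarrow> complex"
  assumes F: "\<And>k. square_integrable (F k)" and cauchy: "L2_Cauchy F"
  obtains f where "square_integrable f" "L2_tendsto F f"
proof -
  note [measurable] = F[THEN square_integrable_measurable] id_measurable_lebesgue
  let ?\<gamma> = "gauss 1 :: real ^ 'n \<Rightarrow> complex"
  define s where "s = (\<lambda>k x. ?\<gamma> x * F k x)"
  have [measurable]: "s k \<in> borel_measurable lebesgue" for k
    unfolding s_def by measurable
  have \<gamma>: "integrable lebesgue (\<lambda>x. (cmod (?\<gamma> x))\<^sup>2)"
  proof -
    have "integrable lborel (gauss 2 :: real ^ 'n \<Rightarrow> complex)"
      by (rule gauss_integrable) simp
    then have "integrable lebesgue (\<lambda>x :: real ^ 'n. cmod (gauss 2 x))"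
      by (auto simp: integrable_completion)
    moreover have "(cmod (?\<gamma> x))\<^sup>2 = cmod (gauss 2 x)" for x
      by (simp add: norm_gauss power2_eq_square exp_add[symmetric])
    ultimately show ?thesis by simp
  qed
  define G where "G = (LINT x|lebesgue. (cmod (?\<gamma> x))\<^sup>2)"
  have "0 \<le> G" by (simp add: G_def)
  \<comment> \<open>The weight \<open>\<delta>\<close> will be chosen so that the fixed Gaussian contributes less than half of the error.\<close>
  have am: "cmod (?\<gamma> x * w) \<le> \<delta> / 2 * (cmod (?\<gamma> x))\<^sup>2 + (cmod w)\<^sup>2 / (2 * \<delta>)" if "0 < \<delta>" for \<delta> w x
  proof -
    have "0 \<le> (\<delta> * cmod (?\<gamma> x) - cmod w)\<^sup>2 / (2 * \<delta>)" using that by simp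
    then show ?thesis using that by (simp add: norm_mult power2_eq_square field_simps)
  qed
  have sq: "integrable lebesgue (\<lambda>x. (cmod (F j x - F k x))\<^sup>2)" for j k
    using square_integrable_diff[OF F F] by (simp add: square_integrable_def)
  have s_int: "integrable lebesgue (s k)" for k
  proof (rule Bochner_Integration.integrable_bound)
    show "integrable lebesgue (\<lambda>x. 1 / 2 * (cmod (?\<gamma> x))\<^sup>2 + (cmod (F k x))\<^sup>2 / (2 * 1))"
      using F[of k] \<gamma> by (auto simp: square_integrable_def)
    show "AE x in lebesgue. norm (s k x) \<le> norm (1 / 2 * (cmod (?\<gamma> x))\<^sup>2 + (cmod (F k x))\<^sup>2 / (2 * 1))"
      using am[of 1] by (auto simp: s_def intro!: AE_I2)
  qed measurable
  obtain r where r: "strict_mono r" "AE x in lebesgue. Cauchy (\<lambda>i. s (r i) x)"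
  proof (rule cauchy_L1_AE_cauchy_subseq[OF s_int])
    fix e :: real assume e: "0 < e"
    define \<delta> where "\<delta> = e / (G + 1)"
    have \<delta>: "0 < \<delta>" "\<delta> * G < e"
      using e \<open>0 \<le> G\<close> by (auto simp: \<delta>_def field_simps)
    obtain K where K: "\<And>j k. j \<ge> K \<Longrightarrow> k \<ge> K \<Longrightarrow> sqnorm (\<lambda>x. F j x - F k x) < ennreal (e * \<delta>)"
      using L2_CauchyD[OF cauchy, of "ennreal (e * \<delta>)"] e \<delta> by auto
    have "(LINT x|lebesgue. norm (s i x - s j x)) < e" if "i \<ge> K" "j \<ge> K" for i j
    proof -
      have "sqnorm (\<lambda>x. F i x - F j x) = ennreal (LINT x|lebesgue. (cmod (F i x - F j x))\<^sup>2)"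
        unfolding sqnorm_def using sq by (intro nn_integral_eq_integral) auto
      with K[OF that] have N: "(LINT x|lebesgue. (cmod (F i x - F j x))\<^sup>2) < e * \<delta>"
        by (auto simp: ennreal_less_iff)
      have "(LINT x|lebesgue. norm (s i x - s j x))
          \<le> (LINT x|lebesgue. \<delta> / 2 * (cmod (?\<gamma> x))\<^sup>2 + (cmod (F i x - F j x))\<^sup>2 / (2 * \<delta>))"
      proof (rule integral_mono)
        show "norm (s i x - s j x) \<le> \<delta> / 2 * (cmod (?\<gamma> x))\<^sup>2 + (cmod (F i x - F j x))\<^sup>2 / (2 * \<delta>)" for x
          using am[OF \<delta>(1), of x "F i x - F j x"] by (simp add: s_def algebra_simps)
      qed (use s_int sq \<gamma> in auto)
      also have "\<dots> = \<delta> / 2 * G + (LINT x|lebesgue. (cmod (F i x - F j x))\<^sup>2) / (2 * \<delta>)"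
        using sq \<gamma> by (simp add: G_def)
      also have "(LINT x|lebesgue. (cmod (F i x - F j x))\<^sup>2) / (2 * \<delta>) < e / 2"
        using N \<delta>(1) by (simp add: field_simps)
      finally show ?thesis using \<delta>(2) by simp
    qed
    then show "\<exists>N. \<forall>i\<ge>N. \<forall>j\<ge>N. (LINT x|lebesgue. norm (s i x - s j x)) < e"
      by blast
  qed
  define f where "f = (\<lambda>x. lim (\<lambda>i. s (r i) x) / ?\<gamma> x)"
  have [measurable]: "f \<in> borel_measurable lebesgue"
    unfolding f_def by measurable
  have "AE x in lebesgue. (\<lambda>i. F (r i) x) \<longlonglongrightarrow> f x"
    using r(2)
  proof eventually_elim
    case (elim x)
    then have "(\<lambda>i. s (r i) x) \<longlonglongrightarrow> lim (\<lambda>i. s (r i) x)"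
      by (simp add: Cauchy_convergent_iff convergent_LIMSEQ_iff)
    then have "(\<lambda>i. s (r i) x / ?\<gamma> x) \<longlonglongrightarrow> f x"
      unfolding f_def by (intro tendsto_intros) (auto simp: gauss_def)
    then show ?case by (simp add: s_def gauss_def)
  qed
  then have "L2_tendsto F f"
    by (intro L2_Cauchy_pointwise[OF _ _ cauchy r(1)]) auto
  moreover from this have "square_integrable f"
    by (intro L2_tendsto_square_integrable[OF F]) auto
  ultimately show ?thesis using that by blast
qed

section \<open>Density of continuous functions of bounded support\<close>

definition C_c :: "(real ^ 'n \<Rightarrow> complex) set" where
  "C_c = {c. continuous_on UNIV c \<and> (\<exists>R. \<forall>x. R < norm x \<longrightarrow> c x = 0)}"

lemma C_cE:
  assumes "c \<in> C_c"
  obtains R where "continuous_on UNIV c" "\<And>x. R < norm x \<Longrightarrow> c x = 0"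
  using assms by (auto simp: C_c_def)

lemma C_c_continuous: "c \<in> C_c \<Longrightarrow> continuous_on UNIV c"
  by (auto simp: C_c_def)

lemma C_c_measurable [measurable_dest]:
  "c \<in> C_c \<Longrightarrow> c \<in> borel_measurable borel"
  by (auto simp: C_c_def intro: borel_measurable_continuous_onI)

lemma C_c_integrable:
  assumes "c \<in> C_c"
  shows "integrable lborel c"
proof -
  obtain R where R: "continuous_on UNIV c" "\<And>x. R < norm x \<Longrightarrow> c x = 0"
    using C_cE[OF assms] by blast
  have "integrable lborel (\<lambda>x. indicator (cball 0 R) x *\<^sub>R c x)"
    using R(1) by (intro borel_integrable_compact) (auto intro: continuous_on_subset)
  also have "(\<lambda>x. indicator (cball 0 R) x *\<^sub>R c x) = c"
    using R(2) by (force simp: indicator_def dist_norm not_le)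
  finally show ?thesis .
qed

lemma C_c_integrable_lebesgue:
  "c \<in> C_c \<Longrightarrow> integrable lebesgue c"
  by (intro integrable_lebesgue_of_lborel C_c_integrable)

lemma C_c_mult:
  assumes "continuous_on UNIV m" "c \<in> C_c"
  shows "(\<lambda>x. m x * c x) \<in> C_c" "(\<lambda>x. c x * m x) \<in> C_c"
  using assms by (auto simp: C_c_def intro!: continuous_intros)

lemma C_c_diff:
  assumes "c \<in> C_c" "d \<in> C_c"
  shows "(\<lambda>x. c x - d x) \<in> C_c"
proof -
  obtain R S where R: "continuous_on UNIV c" "\<And>x. R < norm x \<Longrightarrow> c x = 0"
    and S: "continuous_on UNIV d" "\<And>x. S < norm x \<Longrightarrow> d x = 0"
    using assms C_cE by metis
  then have "\<And>x. max R S < norm x \<Longrightarrow> c x - d x = 0" by simp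
  with R(1) S(1) show ?thesis
    unfolding C_c_def by (blast intro: continuous_on_diff)
qed

lemma C_c_cnj: "c \<in> C_c \<Longrightarrow> (\<lambda>x. cnj (c x)) \<in> C_c"
  by (auto simp: C_c_def intro!: continuous_intros)

lemma C_c_reflect:
  assumes "c \<in> C_c"
  shows "(\<lambda>x. c (- x)) \<in> C_c"
proof -
  obtain R where "continuous_on UNIV c" "\<And>x. R < norm x \<Longrightarrow> c x = 0"
    using C_cE[OF assms] by blast
  then show ?thesis
    unfolding C_c_def
    by (auto intro!: continuous_on_compose2[of UNIV c] continuous_intros exI[of _ R])
qed

lemma C_c_square_integrable:
  assumes "c \<in> C_c"
  shows "square_integrable c"
proof -
  have "(\<lambda>x. cnj (c x) * c x) \<in> C_c"
    using assms by (intro C_c_mult(1) C_c_continuous C_c_cnj)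
  from integrable_norm[OF C_c_integrable_lebesgue[OF this]]
  show ?thesis
    using borel_measurable_integrable[OF C_c_integrable_lebesgue[OF assms]]
    by (simp add: square_integrable_def norm_mult power2_eq_square)
qed

lemma C_c_bounded:
  assumes "c \<in> C_c"
  obtains B where "\<And>x. cmod (c x) \<le> B"
proof -
  obtain R where R: "continuous_on UNIV c" "\<And>x. R < norm x \<Longrightarrow> c x = 0"
    using C_cE[OF assms] by blast
  have "bounded (c ` cball 0 R)"
    using R(1) by (intro compact_imp_bounded compact_continuous_image) (auto intro: continuous_on_subset)
  then obtain B where "\<forall>y\<in>c ` cball 0 R. cmod y \<le> B"
    unfolding bounded_iff by blast
  then have B: "\<And>x. x \<in> cball 0 R \<Longrightarrow> cmod (c x) \<le> B"
    by blast
  have "cmod (c x) \<le> max 0 B" for x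
    by (cases "x \<in> cball 0 R") (use B R(2) in \<open>auto simp: dist_norm not_le le_max_iff_disj\<close>)
  then show ?thesis using that by blast
qed

lemma L1_tendsto_dominated:
  fixes F :: "nat \<Rightarrow> real ^ 'n \<Rightarrow> complex"
  assumes [measurable]: "\<And>k. F k \<in> borel_measurable lebesgue" "f \<in> borel_measurable lebesgue"
    and lim: "AE x in lebesgue. (\<lambda>k. F k x) \<longlonglongrightarrow> f x"
    and g: "integrable lebesgue g" and bd: "\<And>k x. cmod (F k x) \<le> cmod (g x)"
  shows "(\<lambda>k. LINT x|lebesgue. cmod (F k x - f x)) \<longlonglongrightarrow> 0"
proof -
  have "(\<lambda>k. LINT x|lebesgue. cmod (F k x - f x)) \<longlonglongrightarrow> (LINT x|(lebesgue :: (real^'n) measure). 0)"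
  proof (rule integral_dominated_convergence[where w = "\<lambda>x. 2 * cmod (g x)"])
    show "AE x in lebesgue. (\<lambda>k. cmod (F k x - f x)) \<longlonglongrightarrow> 0"
      using lim by eventually_elim (simp add: LIM_zero_iff tendsto_norm_zero_iff)
    show "AE x in lebesgue. norm (cmod (F k x - f x)) \<le> 2 * cmod (g x)" for k
      using lim
    proof eventually_elim
      case (elim x)
      have "cmod (f x) \<le> cmod (g x)"
        using tendsto_norm[OF elim] bd by (intro LIMSEQ_le_const2) auto
      then show ?case
        using bd[of k x] norm_triangle_ineq4[of "F k x" "f x"] by simp
    qed
  qed (use g in auto)
  then show ?thesis by simp
qed

definition clip :: "real \<Rightarrow> complex \<Rightarrow> complex" where
  "clip m w = complex_of_real (m / max m (cmod w)) * w"

lemma clip: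
  assumes "0 < m"
  shows "continuous_on S (clip m)" "cmod (clip m w) \<le> m" "cmod (clip m w) \<le> cmod w"
    "cmod w \<le> m \<Longrightarrow> clip m w = w"
proof -
  show "continuous_on S (clip m)"
    unfolding clip_def using assms by (intro continuous_intros) (auto simp: max_def)
  show "cmod (clip m w) \<le> m" "cmod (clip m w) \<le> cmod w"
    using assms by (auto simp: clip_def norm_mult norm_divide max_def field_simps)
  show "cmod w \<le> m \<Longrightarrow> clip m w = w"
    using assms by (simp add: clip_def max_def)
qed

definition cutoff :: "real \<Rightarrow> real ^ 'n \<Rightarrow> real" where
  "cutoff m x = max 0 (min 1 (m - norm x))"

lemma cutoff:
  "continuous_on S (cutoff m)" "0 \<le> cutoff m x" "cutoff m x \<le> 1"
  "m < norm x \<Longrightarrow> cutoff m x = 0" "norm x + 1 \<le> m \<Longrightarrow> cutoff m x = 1"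
  unfolding cutoff_def by (auto intro!: continuous_intros)

text \<open>A measurable function is almost everywhere the limit of continuous functions \<open>g
  n\<close>. With \<open>T m\<close>, which cuts off values above and arguments beyond \<open>m +
  1\<close>, the functions \<open>T m (g n)\<close> are test functions, they tend to \<open>T m
  h\<close> as \<open>n\<close> grows, and \<open>T m h\<close> tends to \<open>h\<close> as
  \<open>m\<close> grows; both limits are dominated. A diagonal sequence works for the mean square
  and the mean at once, which is what passing to the limit in the Fourier integral requires.\<close>
lemma C_c_dense:
  fixes h :: "real ^ 'n \<Rightarrow> complex"
  assumes h: "square_integrable h"
  obtains c where "\<And>k. c k \<in> C_c" "L2_tendsto c h"
    "integrable lebesgue h \<Longrightarrow> (\<lambda>k. LINT x|lebesgue. cmod (c k x - h x)) \<longlonglongrightarrow> 0"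
proof -
  note [measurable] = square_integrable_measurable[OF h]
  have "h measurable_on UNIV"
    by (intro lebesgue_measurable_imp_measurable_on) auto
  then obtain N g where N: "negligible N" and g: "\<And>n. continuous_on UNIV (g n)"
    and lim: "\<And>x. x \<notin> N \<Longrightarrow> (\<lambda>n. g n x) \<longlonglongrightarrow> h x"
    unfolding measurable_on_def by auto
  have AE_lim: "AE x in lebesgue. (\<lambda>n. g n x) \<longlonglongrightarrow> h x"
    using N lim by (intro AE_I'[of N]) (auto simp: negligible_iff_null_sets)
  define T where "T = (\<lambda>m f (x :: real^'n). complex_of_real (cutoff (real (Suc m)) x) * clip (real (Suc m)) (f x))"
  have [measurable]: "clip (real (Suc m)) \<in> borel_measurable borel"
    "cutoff (real (Suc m)) \<in> borel_measurable (lebesgue :: (real^'n) measure)" for m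
    by (intro borel_measurable_continuous_onI clip cutoff measurable_completion; simp)+
  have Tmeas: "T m f \<in> borel_measurable lebesgue" if [measurable]: "f \<in> borel_measurable lebesgue" for m f
    unfolding T_def by measurable
  have T_le: "cmod (T m f x) \<le> cmod (f x)" for m f x
    using mult_mono[OF cutoff(3)[of "real (Suc m)" x] clip(3)[of "real (Suc m)" "f x"]]
    by (simp add: T_def norm_mult cutoff(2))
  have T_le2: "cmod (T m f x) \<le> cmod (complex_of_real (real (Suc m) * cutoff (real (Suc m)) x))" for m f x
    using mult_left_mono[OF clip(2)[of "real (Suc m)" "f x"] cutoff(2)[of "real (Suc m)" x]]
    by (simp only: T_def norm_mult norm_of_real) (simp add: cutoff(2) mult.commute del: of_nat_Suc)
  have T_Cc: "T m f \<in> C_c" if "continuous_on UNIV f" for m f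
  proof -
    have "continuous_on UNIV (\<lambda>x. clip (real (Suc m)) (f x))"
      using continuous_on_compose2[OF clip(1)[of "real (Suc m)" UNIV] that] by simp
    then show ?thesis
      unfolding T_def C_c_def using cutoff(4)[of "real (Suc m)"]
      by (auto intro!: continuous_intros cutoff(1) simp del: of_nat_Suc)
  qed
  have dom_Cc: "(\<lambda>x. complex_of_real (real (Suc m) * cutoff (real (Suc m)) x)) \<in> C_c" for m
    unfolding C_c_def using cutoff(4)[of "real (Suc m)"]
    by (auto intro!: continuous_intros cutoff(1))
  have g_meas[measurable]: "g n \<in> borel_measurable lebesgue" for n
    using g by (intro measurable_completion) (simp add: borel_measurable_continuous_onI)
  have inner_lim: "AE x in lebesgue. (\<lambda>n. T m (g n) x) \<longlonglongrightarrow> T m h x" for m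
    using AE_lim
  proof eventually_elim
    case (elim x)
    have "isCont (clip (real (Suc m))) (h x)"
      using clip(1)[of "real (Suc m)" UNIV] by (simp add: continuous_on_eq_continuous_at)
    from isCont_tendsto_compose[OF this elim] show ?case
      unfolding T_def by (intro tendsto_intros)
  qed
  have inner_L2: "L2_tendsto (\<lambda>n. T m (g n)) (T m h)" for m
    by (rule L2_tendsto_dominated[OF _ _ inner_lim C_c_square_integrable[OF dom_Cc] T_le2])
       (auto intro!: Tmeas)
  have inner_L1: "(\<lambda>n. LINT x|lebesgue. cmod (T m (g n) x - T m h x)) \<longlonglongrightarrow> 0" for m
    by (rule L1_tendsto_dominated[OF _ _ inner_lim C_c_integrable_lebesgue[OF dom_Cc] T_le2])
       (auto intro!: Tmeas)
  have outer_lim: "AE x in lebesgue. (\<lambda>m. T m h x) \<longlonglongrightarrow> h x"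
  proof (intro AE_I2 tendsto_eventually)
    fix x :: "real^'n"
    obtain M :: nat where M: "max (norm x + 1) (cmod (h x)) \<le> M" using real_arch_simple by blast
    have "T m h x = h x" if "m \<ge> M" for m
    proof -
      have "norm x + 1 \<le> real (Suc m)" "cmod (h x) \<le> real (Suc m)"
        using M that by auto
      then show ?thesis by (simp add: T_def cutoff(5) clip(4))
    qed
    then show "\<forall>\<^sub>F m in sequentially. T m h x = h x"
      using eventually_sequentially by blast
  qed
  have outer_L2: "L2_tendsto (\<lambda>m. T m h) h"
    by (rule L2_tendsto_dominated[OF _ _ outer_lim h T_le]) (auto intro!: Tmeas)
  have outer_L1: "(\<lambda>m. LINT x|lebesgue. cmod (T m h x - h x)) \<longlonglongrightarrow> 0" if "integrable lebesgue h"
    by (rule L1_tendsto_dominated[OF _ _ outer_lim that T_le]) (auto intro!: Tmeas)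
  have "\<exists>n. sqnorm (\<lambda>x. T m (g n) x - T m h x) < ennreal (inverse (real (Suc m)))
      \<and> (LINT x|lebesgue. cmod (T m (g n) x - T m h x)) < inverse (real (Suc m))" for m
  proof -
    have "\<forall>\<^sub>F n in sequentially. sqnorm (\<lambda>x. T m (g n) x - T m h x) < ennreal (inverse (real (Suc m)))"
      using order_tendstoD(2)[OF inner_L2[unfolded L2_tendsto_iff], of "ennreal (inverse (real (Suc m)))"]
      by simp
    moreover have "\<forall>\<^sub>F n in sequentially. (LINT x|lebesgue. cmod (T m (g n) x - T m h x)) < inverse (real (Suc m))"
      using order_tendstoD(2)[OF inner_L1, of "inverse (real (Suc m))"] by simp
    ultimately have "\<forall>\<^sub>F n in sequentially. sqnorm (\<lambda>x. T m (g n) x - T m h x) < ennreal (inverse (real (Suc m)))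
      \<and> (LINT x|lebesgue. cmod (T m (g n) x - T m h x)) < inverse (real (Suc m))"
      by eventually_elim blast
    then show ?thesis by (auto simp: eventually_sequentially)
  qed
  then obtain n where n2: "\<And>m. sqnorm (\<lambda>x. T m (g (n m)) x - T m h x) < ennreal (inverse (real (Suc m)))"
    and n1: "\<And>m. (LINT x|lebesgue. cmod (T m (g (n m)) x - T m h x)) < inverse (real (Suc m))"
    by metis
  show ?thesis
  proof
    show Cc: "T m (g (n m)) \<in> C_c" for m by (rule T_Cc[OF g])
    show "L2_tendsto (\<lambda>m. T m (g (n m))) h"
      by (rule L2_tendsto_diagonal[OF _ _ _ outer_L2 n2]) (auto intro!: Tmeas)
    show "(\<lambda>m. LINT x|lebesgue. cmod (T m (g (n m)) x - h x)) \<longlonglongrightarrow> 0" if hi: "integrable lebesgue h"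
    proof (rule tendsto_sandwich[of "\<lambda>_. 0"])
      show "\<forall>\<^sub>F m in sequentially. (LINT x|lebesgue. cmod (T m (g (n m)) x - h x))
          \<le> inverse (real (Suc m)) + (LINT x|lebesgue. cmod (T m h x - h x))"
      proof (intro always_eventually allI)
        fix m
        have Th: "integrable lebesgue (T m h)"
          by (rule Bochner_Integration.integrable_bound[OF hi]) (auto intro!: Tmeas T_le)
        have i1: "integrable lebesgue (\<lambda>x. cmod (T m (g (n m)) x - T m h x))"
          by (intro integrable_norm Bochner_Integration.integrable_diff C_c_integrable_lebesgue Cc Th)
        have i2: "integrable lebesgue (\<lambda>x. cmod (T m h x - h x))"
          by (intro integrable_norm Bochner_Integration.integrable_diff hi Th)
        have "(LINT x|lebesgue. cmod (T m (g (n m)) x - h x))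
            \<le> (LINT x|lebesgue. cmod (T m (g (n m)) x - T m h x) + cmod (T m h x - h x))"
        proof (rule integral_mono[OF _ Bochner_Integration.integrable_add[OF i1 i2]])
          show "integrable lebesgue (\<lambda>x. cmod (T m (g (n m)) x - h x))"
            by (intro integrable_norm Bochner_Integration.integrable_diff C_c_integrable_lebesgue Cc hi)
          show "cmod (T m (g (n m)) x - h x) \<le> cmod (T m (g (n m)) x - T m h x) + cmod (T m h x - h x)" for x
            using norm_triangle_ineq[of "T m (g (n m)) x - T m h x" "T m h x - h x"] by simp
        qed
        also have "\<dots> = (LINT x|lebesgue. cmod (T m (g (n m)) x - T m h x)) + (LINT x|lebesgue. cmod (T m h x - h x))"
          by (rule Bochner_Integration.integral_add[OF i1 i2])
        also have "\<dots> \<le> inverse (real (Suc m)) + (LINT x|lebesgue. cmod (T m h x - h x))"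
          using n1[of m] by simp
        finally show "(LINT x|lebesgue. cmod (T m (g (n m)) x - h x))
          \<le> inverse (real (Suc m)) + (LINT x|lebesgue. cmod (T m h x - h x))" .
      qed
      show "(\<lambda>m. inverse (real (Suc m)) + (LINT x|lebesgue. cmod (T m h x - h x))) \<longlonglongrightarrow> 0"
        using tendsto_add[OF LIMSEQ_inverse_real_of_nat outer_L1[OF hi]] by simp
    qed (auto intro!: always_eventually Bochner_Integration.integral_nonneg)
  qed
qed

section \<open>The Fourier integral and Plancherel's identity for test functions\<close>

lemma lborel_integral_affine:
  fixes f :: "'a::euclidean_space \<Rightarrow> complex"
  assumes [measurable]: "f \<in> borel_measurable borel" and c: "c \<noteq> 0"
  shows "(LINT x|lborel. f x) = \<bar>c\<bar> ^ DIM('a) *\<^sub>R (LINT x|lborel. f (t + c *\<^sub>R x))"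
proof -
  have "(LINT x|lborel. f x)
      = (LINT x|density (distr lborel borel (\<lambda>x. t + c *\<^sub>R x)) (\<lambda>_. ennreal (\<bar>c\<bar> ^ DIM('a))). f x)"
    using c by (subst lborel_affine[OF c, of t]) (simp add: ennreal_power)
  also have "\<dots> = \<bar>c\<bar> ^ DIM('a) *\<^sub>R (LINT x|lborel. f (t + c *\<^sub>R x))"
    by (subst integral_density) (auto simp: integral_distr)
  finally show ?thesis .
qed

lemma lborel_integral_reflect:
  fixes f :: "'a::euclidean_space \<Rightarrow> complex"
  assumes "f \<in> borel_measurable borel"
  shows "(LINT x|lborel. f (- x)) = (LINT x|lborel. f x)"
  using lborel_integral_affine[OF assms, of "- 1" 0] by simp

lemma fourier_integrand_integrable:
  assumes "integrable lebesgue h"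
  shows "integrable lebesgue (\<lambda>x. h x * exp (- \<i> * complex_of_real (x \<bullet> \<xi>)))"
proof (rule Bochner_Integration.integrable_bound[OF assms])
  note [measurable] = borel_measurable_integrable[OF assms] id_measurable_lebesgue
  show "(\<lambda>x. h x * exp (- \<i> * complex_of_real (x \<bullet> \<xi>))) \<in> borel_measurable lebesgue"
    by measurable
qed (simp add: norm_mult)

abbreviation fourier_const :: "'n itself \<Rightarrow> complex" where
  "fourier_const _ \<equiv> complex_of_real ((2 * pi) powr (- real CARD('n) / 2))"

lemma fourier_integral_diff:
  assumes "integrable lebesgue f" "integrable lebesgue g"
  shows "fourier_integral (\<lambda>x. f x - g x) \<xi> = fourier_integral f \<xi> - fourier_integral g \<xi>"
proof -
  have "(LINT x|lebesgue. (f x - g x) * exp (- \<i> * complex_of_real (x \<bullet> \<xi>)))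
      = (LINT x|lebesgue. f x * exp (- \<i> * complex_of_real (x \<bullet> \<xi>)))
        - (LINT x|lebesgue. g x * exp (- \<i> * complex_of_real (x \<bullet> \<xi>)))"
    unfolding left_diff_distrib
    by (intro Bochner_Integration.integral_diff fourier_integrand_integrable assms)
  then show ?thesis
    by (simp only: fourier_integral_def right_diff_distrib)
qed

lemma fourier_integral_diff_fun:
  assumes "integrable lebesgue f" "integrable lebesgue g"
  shows "fourier_integral (\<lambda>x. f x - g x) = (\<lambda>\<xi>. fourier_integral f \<xi> - fourier_integral g \<xi>)"
  by (rule ext) (rule fourier_integral_diff[OF assms])

lemma norm_fourier_integral_le:
  fixes h :: "real ^ 'n \<Rightarrow> complex"
  assumes "integrable lebesgue h"
  shows "cmod (fourier_integral h \<xi>) \<le> (LINT x|lebesgue. cmod (h x))"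
proof -
  have "(2 * pi) powr (- real CARD('n) / 2) \<le> (2 * pi) powr 0"
    using pi_ge_two by (intro powr_mono) auto
  then have c: "(2 * pi) powr (- real CARD('n) / 2) \<le> 1" by simp
  have "cmod (LINT x|lebesgue. h x * exp (- \<i> * complex_of_real (x \<bullet> \<xi>))) \<le> (LINT x|lebesgue. cmod (h x))"
    using integral_norm_bound[of lebesgue "\<lambda>x. h x * exp (- \<i> * complex_of_real (x \<bullet> \<xi>))"]
    by (simp add: norm_mult)
  from mult_mono[OF c this] show ?thesis
    by (simp add: fourier_integral_def norm_mult)
qed

lemma fourier_integral_continuous:
  fixes h :: "real ^ 'n \<Rightarrow> complex"
  assumes h: "integrable lebesgue h"
  shows "continuous_on S (fourier_integral h)"
proof -
  note [measurable] = borel_measurable_integrable[OF h] id_measurable_lebesgue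
  have "isCont (fourier_integral h) \<xi>" for \<xi>
    unfolding continuous_at_sequentially comp_def
  proof (intro allI impI)
    fix X assume X: "X \<longlonglongrightarrow> \<xi>"
    have "(\<lambda>k. LINT x|lebesgue. h x * exp (- \<i> * complex_of_real (x \<bullet> X k)))
        \<longlonglongrightarrow> (LINT x|lebesgue. h x * exp (- \<i> * complex_of_real (x \<bullet> \<xi>)))"
    proof (rule integral_dominated_convergence[where w = "\<lambda>x. cmod (h x)"])
      show "AE x in lebesgue. (\<lambda>k. h x * exp (- \<i> * complex_of_real (x \<bullet> X k)))
          \<longlonglongrightarrow> h x * exp (- \<i> * complex_of_real (x \<bullet> \<xi>))"
        by (intro AE_I2 tendsto_intros X)
    qed (use h in \<open>auto simp: norm_mult\<close>)
    then show "(\<lambda>k. fourier_integral h (X k)) \<longlonglongrightarrow> fourier_integral h \<xi>"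
      unfolding fourier_integral_def by (intro tendsto_intros)
  qed
  then show ?thesis
    by (simp add: continuous_at_imp_continuous_on)
qed

lemma fourier_integral_measurable:
  assumes "integrable lebesgue h"
  shows "fourier_integral h \<in> borel_measurable borel" "fourier_integral h \<in> borel_measurable lebesgue"
  by (intro borel_measurable_continuous_onI continuous_measurable_lebesgue fourier_integral_continuous assms)+

lemma fourier_integral_cnj:
  "fourier_integral (\<lambda>x. cnj (h x)) \<xi> = cnj (fourier_integral h (- \<xi>))"
proof -
  have "(LINT x|lebesgue. cnj (h x) * exp (- \<i> * complex_of_real (x \<bullet> \<xi>)))
      = (LINT x|lebesgue. cnj (h x * exp (- \<i> * complex_of_real (x \<bullet> (- \<xi>)))))"
    by (simp add: exp_cnj)
  also have "\<dots> = cnj (LINT x|lebesgue. h x * exp (- \<i> * complex_of_real (x \<bullet> (- \<xi>))))"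
    by (rule Bochner_Integration.integral_cnj)
  finally show ?thesis by (simp add: fourier_integral_def)
qed

lemma fourier_integral_reflect:
  assumes [measurable]: "f \<in> borel_measurable borel"
  shows "fourier_integral (\<lambda>x. f (- x)) \<xi> = fourier_integral f (- \<xi>)"
  using lborel_integral_reflect[of "\<lambda>x. f x * exp (- \<i> * complex_of_real (x \<bullet> (- \<xi>)))"]
  by (simp add: fourier_integral_lborel)

text \<open>Fubini, as the kernel \<open>exp (- \<i> x \<bullet> \<xi>)\<close> is symmetric. All
  interchanges of integrals below are instances of this formula.\<close>
lemma fourier_multiplication_formula:
  fixes h k :: "real ^ 'n \<Rightarrow> complex"
  assumes h: "integrable lborel h" and k: "integrable lborel k"
  shows "(LINT \<xi>|lborel. fourier_integral h \<xi> * k \<xi>) = (LINT x|lborel. h x * fourier_integral k x)"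
proof -
  note [measurable] = borel_measurable_integrable[OF h] borel_measurable_integrable[OF k]
  let ?e = "\<lambda>x \<xi> :: real ^ 'n. exp (- \<i> * complex_of_real (x \<bullet> \<xi>))"
  let ?C = "fourier_const TYPE('n)"
  have "integrable (lborel \<Otimes>\<^sub>M lborel) (\<lambda>(x, \<xi>). h x * k \<xi> * ?e x \<xi>)"
  proof (rule lborel_pair.Fubini_integrable)
    show "integrable lborel (\<lambda>x. LINT \<xi>|lborel. norm (case (x, \<xi>) of (x, \<xi>) \<Rightarrow> h x * k \<xi> * ?e x \<xi>))"
      using h by (simp add: norm_mult)
    have "integrable lborel (\<lambda>\<xi>. h x * k \<xi> * ?e x \<xi>)" for x
      by (rule Bochner_Integration.integrable_bound[OF integrable_mult_right[OF k, of "h x"]])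
         (auto simp: norm_mult)
    then show "AE x in lborel. integrable lborel (\<lambda>\<xi>. case (x, \<xi>) of (x, \<xi>) \<Rightarrow> h x * k \<xi> * ?e x \<xi>)"
      by simp
  qed measurable
  from lborel_pair.Fubini_integral[OF this]
  have F: "(LINT \<xi>|lborel. LINT x|lborel. h x * k \<xi> * ?e x \<xi>) = (LINT x|lborel. LINT \<xi>|lborel. h x * k \<xi> * ?e x \<xi>)"
    by simp
  have "(LINT \<xi>|lborel. fourier_integral h \<xi> * k \<xi>) = (LINT \<xi>|lborel. ?C * (LINT x|lborel. h x * k \<xi> * ?e x \<xi>))"
  proof (intro Bochner_Integration.integral_cong refl)
    fix \<xi>
    have "(LINT x|lborel. h x * k \<xi> * ?e x \<xi>) = (LINT x|lborel. (h x * ?e x \<xi>) * k \<xi>)"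
      by (simp add: ac_simps)
    then show "fourier_integral h \<xi> * k \<xi> = ?C * (LINT x|lborel. h x * k \<xi> * ?e x \<xi>)"
      by (simp add: fourier_integral_lborel)
  qed
  also have "\<dots> = (LINT x|lborel. ?C * (LINT \<xi>|lborel. h x * k \<xi> * ?e x \<xi>))"
    using F by simp
  also have "\<dots> = (LINT x|lborel. h x * fourier_integral k x)"
  proof (intro Bochner_Integration.integral_cong refl)
    fix x
    have "(LINT \<xi>|lborel. h x * k \<xi> * ?e x \<xi>) = (LINT \<xi>|lborel. h x * (k \<xi> * ?e \<xi> x))"
      by (simp add: ac_simps inner_commute)
    then show "?C * (LINT \<xi>|lborel. h x * k \<xi> * ?e x \<xi>) = h x * fourier_integral k x"
      by (simp add: fourier_integral_lborel)
  qed
  finally show ?thesis .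
qed

lemma fourier_integral_gauss_modulated:
  fixes x y :: "real ^ 'n"
  assumes "0 < Re z"
  shows "fourier_integral (\<lambda>\<xi>. gauss z \<xi> * exp (\<i> * complex_of_real (\<xi> \<bullet> x))) y
    = (1 / csqrt z) ^ CARD('n) * gauss (1 / z) (y - x)"
proof -
  have "fourier_integral (\<lambda>\<xi>. gauss z \<xi> * exp (\<i> * complex_of_real (\<xi> \<bullet> x))) y
      = fourier_integral (gauss z) (y - x)"
    unfolding fourier_integral_def mult.assoc exp_add[symmetric]
    by (simp add: inner_diff_right algebra_simps)
  then show ?thesis by (simp add: fourier_integral_gauss[OF assms])
qed

text \<open>For positive \<open>z\<close> this is the solution of the heat equation with initial
  value \<open>h\<close> at time \<open>z / 2\<close>; for \<open>z = 2 \<i> T\<close> it is the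
  free Schroedinger evolution at time \<open>T\<close>.\<close>
definition gauss_conv :: "complex \<Rightarrow> (real ^ 'n \<Rightarrow> complex) \<Rightarrow> real ^ 'n \<Rightarrow> complex" where
  "gauss_conv z h x = fourier_const TYPE('n) * (1 / csqrt z) ^ CARD('n) *
     (LINT y|lborel. h y * gauss (1 / z) (y - x))"

lemma gauss_times_fourier_integrable:
  assumes "0 < Re z" "integrable lebesgue h"
  shows "integrable lborel (\<lambda>\<xi>. gauss z \<xi> * fourier_integral h \<xi>)"
proof (rule Bochner_Integration.integrable_bound)
  note [measurable] = fourier_integral_measurable(1)[OF assms(2)]
  show "integrable lborel (\<lambda>\<xi>. gauss z \<xi> * complex_of_real (LINT x|lebesgue. cmod (h x)))"
    using gauss_integrable[OF assms(1)] by (intro integrable_mult_left)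
  show "(\<lambda>\<xi>. gauss z \<xi> * fourier_integral h \<xi>) \<in> borel_measurable lborel"
    by measurable
  show "AE \<xi> in lborel. norm (gauss z \<xi> * fourier_integral h \<xi>)
      \<le> norm (gauss z \<xi> * complex_of_real (LINT x|lebesgue. cmod (h x)))"
  proof (rule AE_I2)
    fix \<xi>
    have "cmod (fourier_integral h \<xi>) \<le> \<bar>LINT x|lebesgue. cmod (h x)\<bar>"
      using norm_fourier_integral_le[OF assms(2), of \<xi>] by linarith
    then show "norm (gauss z \<xi> * fourier_integral h \<xi>)
      \<le> norm (gauss z \<xi> * complex_of_real (LINT x|lebesgue. cmod (h x)))"
      unfolding norm_mult norm_of_real by (intro mult_left_mono) auto
  qed
qed

text \<open>Regularised Fourier inversion: the multiplication formula moves the transform from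
  \<open>h\<close> to a modulated Gaussian, whose transform is a translated Gaussian.\<close>
lemma fourier_inverse_gauss_times_fourier:
  fixes h :: "real ^ 'n \<Rightarrow> complex"
  assumes z: "0 < Re z" and h: "integrable lborel h"
  shows "fourier_integral (\<lambda>\<xi>. gauss z \<xi> * fourier_integral h \<xi>) (- x) = gauss_conv z h x"
proof -
  have h': "integrable lebesgue h" using h by (rule integrable_lebesgue_of_lborel)
  note [measurable] = fourier_integral_measurable(1)[OF h']
  have "integrable lborel (\<lambda>\<xi>. gauss z \<xi> * exp (\<i> * complex_of_real (\<xi> \<bullet> x)))"
    by (rule Bochner_Integration.integrable_bound[OF gauss_integrable[OF z]]) (auto simp: norm_mult)
  from fourier_multiplication_formula[OF h this]
  have "(LINT \<xi>|lborel. fourier_integral h \<xi> * (gauss z \<xi> * exp (\<i> * complex_of_real (\<xi> \<bullet> x))))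
      = (LINT y|lborel. h y * ((1 / csqrt z) ^ CARD('n) * gauss (1 / z) (y - x)))"
    by (simp only: fourier_integral_gauss_modulated[OF z])
  also have "\<dots> = (LINT y|lborel. (1 / csqrt z) ^ CARD('n) * (h y * gauss (1 / z) (y - x)))"
    by (simp only: mult.left_commute)
  also have "\<dots> = (1 / csqrt z) ^ CARD('n) * (LINT y|lborel. h y * gauss (1 / z) (y - x))"
    by (rule integral_mult_right_zero)
  finally have "(LINT \<xi>|lborel. gauss z \<xi> * fourier_integral h \<xi> * exp (- \<i> * complex_of_real (\<xi> \<bullet> (- x))))
      = (1 / csqrt z) ^ CARD('n) * (LINT y|lborel. h y * gauss (1 / z) (y - x))"
    by (simp add: ac_simps)
  then show ?thesis
    by (simp add: fourier_integral_lborel gauss_conv_def)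
qed

text \<open>For positive \<open>e\<close> the substitution \<open>y = x + sqrt e *\<^sub>R w\<close>
  turns the convolution into an average of \<open>h\<close> near \<open>x\<close> against a fixed
  Gaussian.\<close>
lemma gauss_conv_heat:
  fixes h :: "real ^ 'n \<Rightarrow> complex"
  assumes [measurable]: "h \<in> borel_measurable borel" and e: "0 < e"
  shows "gauss_conv (complex_of_real e) h x
    = fourier_const TYPE('n) * (LINT w|lborel. h (x + sqrt e *\<^sub>R w) * gauss 1 w)"
proof -
  have "(LINT y|lborel. h y * gauss (1 / complex_of_real e) (y - x))
     = \<bar>sqrt e\<bar> ^ DIM(real ^ 'n) *\<^sub>R (LINT w|lborel. h (x + sqrt e *\<^sub>R w) * gauss (1 / complex_of_real e) (x + sqrt e *\<^sub>R w - x))"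
    using e by (intro lborel_integral_affine) auto
  also have "(\<lambda>w :: real ^ 'n. gauss (1 / complex_of_real e) (x + sqrt e *\<^sub>R w - x)) = gauss 1"
    using e by (simp add: gauss_def fun_eq_iff power_mult_distrib)
  finally have "(LINT y|lborel. h y * gauss (1 / complex_of_real e) (y - x))
      = complex_of_real (sqrt e) ^ CARD('n) * (LINT w|lborel. h (x + sqrt e *\<^sub>R w) * gauss 1 w)"
    using e by (simp add: scaleR_conv_of_real fun_eq_iff)
  then show ?thesis
    using e by (simp add: gauss_conv_def csqrt_of_real_nonneg power_divide)
qed

lemma gauss_total_mass: "fourier_const TYPE('n) * (LINT w :: real ^ 'n|lborel. gauss 1 w) = 1"
  using fourier_integral_gauss[of 1 "0 :: real ^ 'n"]
  by (simp add: fourier_integral_lborel gauss_def)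

lemma gauss_conv_heat_tendsto:
  fixes h :: "real ^ 'n \<Rightarrow> complex"
  assumes h: "h \<in> C_c" and e: "\<And>k. 0 < e k" "e \<longlonglongrightarrow> 0"
  shows "(\<lambda>k. gauss_conv (complex_of_real (e k)) h x) \<longlonglongrightarrow> h x"
proof -
  note [measurable] = C_c_measurable[OF h]
  obtain B where B: "\<And>x. cmod (h x) \<le> B" using C_c_bounded[OF h] by blast
  have "(\<lambda>k. LINT w|lborel. h (x + sqrt (e k) *\<^sub>R w) * gauss 1 w) \<longlonglongrightarrow> (LINT w|lborel. h (x + sqrt 0 *\<^sub>R w) * gauss 1 w)"
  proof (rule integral_dominated_convergence[where w = "\<lambda>w. B * cmod (gauss 1 w)"])
    show "integrable lborel (\<lambda>w. B * cmod (gauss 1 (w :: real ^ 'n)))"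
      by (intro integrable_mult_right integrable_norm gauss_integrable) simp
    show "AE w in lborel. (\<lambda>k. h (x + sqrt (e k) *\<^sub>R w) * gauss 1 w) \<longlonglongrightarrow> h (x + sqrt 0 *\<^sub>R w) * gauss 1 w"
    proof (intro AE_I2 tendsto_mult tendsto_const)
      fix w
      have "isCont h (x + sqrt 0 *\<^sub>R w)"
        using C_c_continuous[OF h] by (simp add: continuous_on_eq_continuous_at)
      then show "(\<lambda>k. h (x + sqrt (e k) *\<^sub>R w)) \<longlonglongrightarrow> h (x + sqrt 0 *\<^sub>R w)"
        by (rule isCont_tendsto_compose) (intro tendsto_intros e)
    qed
    show "AE w in lborel. norm (h (x + sqrt (e k) *\<^sub>R w) * gauss 1 w) \<le> B * cmod (gauss 1 w)" for k
      by (intro AE_I2) (auto simp: norm_mult intro!: mult_right_mono B)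
  qed measurable
  then have "(\<lambda>k. gauss_conv (complex_of_real (e k)) h x)
      \<longlonglongrightarrow> fourier_const TYPE('n) * (LINT w|lborel. h (x + sqrt 0 *\<^sub>R w) * gauss 1 w)"
    unfolding gauss_conv_heat[OF C_c_measurable[OF h] e(1)] by (intro tendsto_intros)
  also have "fourier_const TYPE('n) * (LINT w|lborel. h (x + sqrt 0 *\<^sub>R w) * gauss 1 w)
      = h x * (fourier_const TYPE('n) * (LINT w :: real ^ 'n|lborel. gauss 1 w))"
    by simp
  finally show ?thesis unfolding gauss_total_mass by simp
qed

lemma gauss_conv_heat_bounded:
  fixes h :: "real ^ 'n \<Rightarrow> complex"
  assumes h: "h \<in> C_c"
  obtains B where "\<And>e x. 0 < e \<Longrightarrow> cmod (gauss_conv (complex_of_real e) h x) \<le> B"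
proof -
  note [measurable] = C_c_measurable[OF h]
  obtain B where B: "\<And>x. cmod (h x) \<le> B" using C_c_bounded[OF h] by blast
  let ?C = "fourier_const TYPE('n)"
  have "cmod (gauss_conv (complex_of_real e) h x) \<le> cmod ?C * (LINT w :: real ^ 'n|lborel. B * cmod (gauss 1 w))"
    if "0 < e" for e x
  proof -
    have "norm (LINT w|lborel. h (x + sqrt e *\<^sub>R w) * gauss 1 w) \<le> (LINT w :: real ^ 'n|lborel. B * cmod (gauss 1 w))"
    proof (rule Bochner_Integration.integral_norm_bound_integral)
      show i: "integrable lborel (\<lambda>w. B * cmod (gauss 1 (w :: real ^ 'n)))"
        by (intro integrable_mult_right integrable_norm gauss_integrable) simp
      show b: "norm (h (x + sqrt e *\<^sub>R w) * gauss 1 w) \<le> B * cmod (gauss 1 w)" for w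
        by (auto simp: norm_mult intro!: mult_right_mono B)
      show "integrable lborel (\<lambda>w. h (x + sqrt e *\<^sub>R w) * gauss 1 w)"
        using order_trans[OF b abs_ge_self]
        by (intro Bochner_Integration.integrable_bound[OF i]) auto
    qed
    then show ?thesis
      unfolding gauss_conv_heat[OF C_c_measurable[OF h] that] norm_mult by (intro mult_left_mono) auto
  qed
  then show ?thesis using that by blast
qed

text \<open>By the multiplication formula, the integral \<open>r k\<close> of
  \<open>\<bar>fourier_integral h\<bar>\<^sup>2\<close> against the Gaussian with parameter \<open>e
  k\<close> equals that of \<open>cnj h\<close> against the convolution of \<open>h\<close> with a
  narrow Gaussian, which tends to the integral of \<open>\<bar>h\<bar>\<^sup>2\<close>. The Gaussian
  weights are at most 1 and tend to 1, so one inequality between the two norms is immediate and the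
  other is Fatou's lemma.\<close>
lemma plancherel_C_c:
  fixes h :: "real ^ 'n \<Rightarrow> complex"
  assumes h: "h \<in> C_c"
  shows "sqnorm (fourier_integral h) = sqnorm h"
proof -
  define e where "e = (\<lambda>k. inverse (real (Suc k)))"
  have e: "0 < e k" "e \<longlonglongrightarrow> 0" for k
    unfolding e_def using LIMSEQ_inverse_real_of_nat by auto
  let ?g = "\<lambda>k. gauss (complex_of_real (e k))"
  note hb = C_c_integrable[OF h] and hl = C_c_integrable_lebesgue[OF h]
  note [measurable] = C_c_measurable[OF h] fourier_integral_measurable(1)[OF hl]
  define r where "r = (\<lambda>k. LINT \<xi>|lborel. exp (- e k * (norm \<xi>)\<^sup>2 / 2) * (cmod (fourier_integral h \<xi>))\<^sup>2)"
  have k_int: "integrable lborel (\<lambda>\<xi>. ?g k \<xi> * fourier_integral h \<xi>)" for k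
    using gauss_times_fourier_integrable[of "complex_of_real (e k)" h] e hl by simp
  \<comment> \<open>Conjugating a transform reflects its argument, so a reflected integrand is needed as well.\<close>
  have k_int': "integrable lborel (\<lambda>\<xi>. ?g k (- \<xi>) * fourier_integral h (- \<xi>))" for k
  proof -
    from gauss_times_fourier_integrable[OF _ C_c_integrable_lebesgue[OF C_c_reflect[OF h]], of "complex_of_real (e k)"]
    show ?thesis
      using e by (simp add: fourier_integral_reflect gauss_def)
  qed
  have norm_square: "(complex_of_real (cmod w))\<^sup>2 = w * cnj w" for w
    by (metis complex_norm_square of_real_power)
  have r_eq: "complex_of_real (r k) = (LINT x|lborel. cnj (h x) * gauss_conv (complex_of_real (e k)) h x)" for k
  proof -
    let ?k = "\<lambda>\<xi>. ?g k \<xi> * fourier_integral h \<xi>"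
    have "complex_of_real (r k) = (LINT \<xi>|lborel. fourier_integral (\<lambda>x. cnj (h x)) (- \<xi>) * ?k \<xi>)"
      unfolding r_def integral_complex_of_real[symmetric]
      by (intro Bochner_Integration.integral_cong refl)
         (simp add: fourier_integral_cnj gauss_def norm_square exp_of_real[symmetric] ac_simps)
    also have "\<dots> = (LINT \<xi>|lborel. fourier_integral (\<lambda>x. cnj (h x)) \<xi> * ?k (- \<xi>))"
      using fourier_integral_measurable(1)[OF C_c_integrable_lebesgue[OF C_c_cnj[OF h]]]
      by (subst lborel_integral_reflect[symmetric]) (auto simp del: fourier_integral_cnj)
    also have "\<dots> = (LINT x|lborel. cnj (h x) * fourier_integral (\<lambda>\<xi>. ?k (- \<xi>)) x)"
      by (rule fourier_multiplication_formula[OF C_c_integrable[OF C_c_cnj[OF h]] k_int'])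
    also have "\<dots> = (LINT x|lborel. cnj (h x) * gauss_conv (complex_of_real (e k)) h x)"
      using e by (subst fourier_integral_reflect) (auto simp: fourier_inverse_gauss_times_fourier[OF _ hb])
    finally show ?thesis .
  qed
  define s where "s = (LINT x|lborel. (cmod (h x))\<^sup>2)"
  obtain B where B: "\<And>e x. 0 < e \<Longrightarrow> cmod (gauss_conv (complex_of_real e) h x) \<le> B"
    using gauss_conv_heat_bounded[OF h] by blast
  have conv_meas: "gauss_conv (complex_of_real (e k)) h \<in> borel_measurable borel" for k
  proof -
    have "gauss_conv (complex_of_real (e k)) h = (\<lambda>x. fourier_integral (\<lambda>\<xi>. ?g k \<xi> * fourier_integral h \<xi>) (- x))"
      using e by (auto simp: fourier_inverse_gauss_times_fourier[OF _ hb])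
    then show ?thesis
      using fourier_integral_measurable(1)[OF integrable_lebesgue_of_lborel[OF k_int[of k]]] by simp
  qed
  have "(\<lambda>k. LINT x|lborel. cnj (h x) * gauss_conv (complex_of_real (e k)) h x) \<longlonglongrightarrow> (LINT x|lborel. cnj (h x) * h x)"
  proof (rule integral_dominated_convergence[where w = "\<lambda>x. B * cmod (h x)"])
    show "AE x in lborel. norm (cnj (h x) * gauss_conv (complex_of_real (e k)) h x) \<le> B * cmod (h x)" for k
      using B[OF e(1)] by (auto simp: norm_mult mult.commute[of B] intro!: AE_I2 mult_left_mono)
    show "AE x in lborel. (\<lambda>k. cnj (h x) * gauss_conv (complex_of_real (e k)) h x) \<longlonglongrightarrow> cnj (h x) * h x"
      by (intro AE_I2 tendsto_intros gauss_conv_heat_tendsto h e)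
    note [measurable] = conv_meas
    have [measurable]: "cnj \<in> borel_measurable borel"
      by (intro borel_measurable_continuous_onI continuous_intros)
    show "(\<lambda>x. cnj (h x) * h x) \<in> borel_measurable lborel"
      "\<And>k. (\<lambda>x. cnj (h x) * gauss_conv (complex_of_real (e k)) h x) \<in> borel_measurable lborel"
      by measurable
  qed (use hb in auto)
  also have "(LINT x|lborel. cnj (h x) * h x) = complex_of_real s"
    unfolding s_def integral_complex_of_real[symmetric]
    by (simp add: norm_square mult.commute)
  finally have rs: "r \<longlonglongrightarrow> s"
    unfolding r_eq[symmetric] using tendsto_of_real_iff by blast
  have s_eq: "sqnorm h = ennreal s"
  proof -
    have "integrable lebesgue (\<lambda>x. (cmod (h x))\<^sup>2)"
      using C_c_square_integrable[OF h] by (simp add: square_integrable_def)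
    from nn_integral_eq_integral[OF this] show ?thesis
      by (simp add: sqnorm_def s_def integral_completion)
  qed
  have r_eq': "ennreal (r k) = (\<integral>\<^sup>+ \<xi>. ennreal (exp (- e k * (norm \<xi>)\<^sup>2 / 2) * (cmod (fourier_integral h \<xi>))\<^sup>2) \<partial>lebesgue)" for k
  proof -
    have "integrable lborel (\<lambda>\<xi>. exp (- e k * (norm \<xi>)\<^sup>2 / 2) * (cmod (fourier_integral h \<xi>))\<^sup>2)"
    proof (rule Bochner_Integration.integrable_bound)
      show "integrable lborel (\<lambda>\<xi>. (LINT x|lebesgue. cmod (h x)) * cmod (?g k \<xi> * fourier_integral h \<xi>))"
        using k_int by (intro integrable_mult_right integrable_norm)
      show "AE \<xi> in lborel. norm (exp (- e k * (norm \<xi>)\<^sup>2 / 2) * (cmod (fourier_integral h \<xi>))\<^sup>2)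
          \<le> norm ((LINT x|lebesgue. cmod (h x)) * cmod (?g k \<xi> * fourier_integral h \<xi>))"
      proof (rule AE_I2)
        fix \<xi>
        have "cmod (fourier_integral h \<xi>) * (exp (- e k * (norm \<xi>)\<^sup>2 / 2) * cmod (fourier_integral h \<xi>))
          \<le> (LINT x|lebesgue. cmod (h x)) * (exp (- e k * (norm \<xi>)\<^sup>2 / 2) * cmod (fourier_integral h \<xi>))"
          by (intro mult_right_mono norm_fourier_integral_le hl) auto
        then show "norm (exp (- e k * (norm \<xi>)\<^sup>2 / 2) * (cmod (fourier_integral h \<xi>))\<^sup>2)
          \<le> norm ((LINT x|lebesgue. cmod (h x)) * cmod (?g k \<xi> * fourier_integral h \<xi>))"
          by (simp add: norm_mult norm_gauss power2_eq_square ac_simps)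
      qed
    qed measurable
    from nn_integral_eq_integral[OF this] show ?thesis
      by (simp add: r_def nn_integral_completion)
  qed
  have rs': "(\<lambda>k. ennreal (r k)) \<longlonglongrightarrow> ennreal s"
    using rs by (rule tendsto_ennrealI)
  show ?thesis
  proof (rule antisym)
    have "sqnorm (fourier_integral h) = (\<integral>\<^sup>+ \<xi>. liminf (\<lambda>k. ennreal (exp (- e k * (norm \<xi>)\<^sup>2 / 2) * (cmod (fourier_integral h \<xi>))\<^sup>2)) \<partial>lebesgue)"
      unfolding sqnorm_def
    proof (intro nn_integral_cong)
      fix \<xi>
      have "(\<lambda>k. ennreal (exp (- e k * (norm \<xi>)\<^sup>2 / 2) * (cmod (fourier_integral h \<xi>))\<^sup>2))
          \<longlonglongrightarrow> ennreal (exp (- 0 * (norm \<xi>)\<^sup>2 / 2) * (cmod (fourier_integral h \<xi>))\<^sup>2)"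
        by (intro tendsto_intros e) auto
      from lim_imp_Liminf[OF trivial_limit_sequentially this]
      show "ennreal ((cmod (fourier_integral h \<xi>))\<^sup>2)
          = liminf (\<lambda>k. ennreal (exp (- e k * (norm \<xi>)\<^sup>2 / 2) * (cmod (fourier_integral h \<xi>))\<^sup>2))"
        by simp
    qed
    also have "\<dots> \<le> liminf (\<lambda>k. ennreal (r k))"
      unfolding r_eq' by (intro nn_integral_liminf) (auto intro!: measurable_completion)
    also have "\<dots> = sqnorm h"
      using lim_imp_Liminf[OF trivial_limit_sequentially rs'] s_eq by simp
    finally show "sqnorm (fourier_integral h) \<le> sqnorm h" .
    have "ennreal (r k) \<le> sqnorm (fourier_integral h)" for k
      unfolding r_eq' sqnorm_def
      using e(1)[of k] by (intro nn_integral_mono ennreal_leI mult_left_le_one_le) auto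
    then show "sqnorm h \<le> sqnorm (fourier_integral h)"
      unfolding s_eq using rs' by (intro LIMSEQ_le_const2) auto
  qed
qed

section \<open>The Fourier transform of square integrable functions\<close>

lemma sqnorm_fourier_integral_diff_C_c:
  assumes "c \<in> C_c" "d \<in> C_c"
  shows "sqnorm (\<lambda>\<xi>. fourier_integral c \<xi> - fourier_integral d \<xi>) = sqnorm (\<lambda>x. c x - d x)"
  using plancherel_C_c[OF C_c_diff[OF assms]]
  by (simp add: fourier_integral_diff_fun[OF assms[THEN C_c_integrable_lebesgue]])

text \<open>Take test functions that tend to \<open>h\<close> both in the mean and in the mean
  square. Their transforms converge uniformly by the former, and form a Cauchy sequence in the mean
  square by Plancherel's identity and the latter.\<close>
lemma fourier_integral_C_c_approx:
  fixes h :: "real ^ 'n \<Rightarrow> complex"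
  assumes h1: "integrable lebesgue h" and h2: "square_integrable h"
  obtains c where "\<And>k. c k \<in> C_c" "L2_tendsto c h" "L2_tendsto (\<lambda>k. fourier_integral (c k)) (fourier_integral h)"
proof -
  obtain c where c: "\<And>k. c k \<in> C_c" and cL2: "L2_tendsto c h"
    and "integrable lebesgue h \<Longrightarrow> (\<lambda>k. LINT x|lebesgue. cmod (c k x - h x)) \<longlonglongrightarrow> 0"
    by (rule C_c_dense[OF h2]) blast
  then have cL1: "(\<lambda>k. LINT x|lebesgue. cmod (c k x - h x)) \<longlonglongrightarrow> 0"
    using h1 by blast
  have "L2_Cauchy c"
    by (intro L2_tendsto_imp_Cauchy[OF _ _ cL2] square_integrable_measurable C_c_square_integrable c h2)
  then have cauchy: "L2_Cauchy (\<lambda>k. fourier_integral (c k))"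
    by (rule L2_Cauchy_mono[where c = 1]) (auto simp: sqnorm_fourier_integral_diff_C_c[OF c c])
  have "(\<lambda>k. fourier_integral (c k) \<xi>) \<longlonglongrightarrow> fourier_integral h \<xi>" for \<xi>
  proof (rule Lim_null_comparison[THEN LIM_zero_cancel, OF always_eventually cL1])
    show "\<forall>k. norm (fourier_integral (c k) \<xi> - fourier_integral h \<xi>) \<le> (LINT x|lebesgue. cmod (c k x - h x))"
      using norm_fourier_integral_le[OF Bochner_Integration.integrable_diff[OF C_c_integrable_lebesgue[OF c] h1]]
      by (simp add: fourier_integral_diff[OF C_c_integrable_lebesgue[OF c] h1])
  qed
  then have "L2_tendsto (\<lambda>k. fourier_integral (c k)) (fourier_integral h)"
    by (intro L2_Cauchy_pointwise[where r = id, OF _ _ cauchy] AE_I2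
        fourier_integral_measurable(2)[OF C_c_integrable_lebesgue[OF c]] fourier_integral_measurable(2)[OF h1])
       (simp_all add: strict_mono_def)
  with c cL2 show ?thesis using that by blast
qed

lemma fourier_integral_square_integrable:
  assumes "integrable lebesgue h" "square_integrable h"
  shows "square_integrable (fourier_integral h)"
    and plancherel: "sqnorm (fourier_integral h) = sqnorm h"
proof -
  obtain c where c: "\<And>k. c k \<in> C_c" "L2_tendsto c h"
    "L2_tendsto (\<lambda>k. fourier_integral (c k)) (fourier_integral h)"
    using fourier_integral_C_c_approx[OF assms] by blast
  show *: "sqnorm (fourier_integral h) = sqnorm h"
    by (rule sqnorm_eq_limit[OF _ _ _ _ c(2,3) plancherel_C_c[OF c(1)]])
       (intro square_integrable_measurable C_c_square_integrable c assms
          fourier_integral_measurable(2) C_c_integrable_lebesgue)+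
  show "square_integrable (fourier_integral h)"
    using * assms fourier_integral_measurable(2) by (simp add: square_integrable_iff)
qed

lemma L2_tendsto_const: "L2_tendsto (\<lambda>_. f) f"
  by (simp add: L2_tendsto_iff sqnorm_def)

lemma is_fourier_transform_fourier_integral:
  assumes "integrable lebesgue h" "square_integrable h"
  shows "is_fourier_transform h (fourier_integral h)"
  unfolding is_fourier_transform_def
  using assms fourier_integral_square_integrable(1)[OF assms]
  by (auto intro!: exI[of _ "\<lambda>_. h"] L2_tendsto_const)

lemma is_fourier_transformD:
  assumes "is_fourier_transform f g"
  obtains F where "\<And>k. integrable lebesgue (F k)" "\<And>k. square_integrable (F k)"
    "L2_tendsto F f" "L2_tendsto (\<lambda>k. fourier_integral (F k)) g"
  using assms unfolding is_fourier_transform_def by blast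

lemma is_fourier_transform_square_integrable:
  "is_fourier_transform f g \<Longrightarrow> square_integrable g"
  by (simp add: is_fourier_transform_def)

lemma is_fourier_transform_diff:
  assumes f: "f \<in> borel_measurable lebesgue" "f' \<in> borel_measurable lebesgue"
    and "is_fourier_transform f g" "is_fourier_transform f' g'"
  shows "is_fourier_transform (\<lambda>x. f x - f' x) (\<lambda>\<xi>. g \<xi> - g' \<xi>)"
proof -
  obtain F where F: "\<And>k. integrable lebesgue (F k)" "\<And>k. square_integrable (F k)"
    "L2_tendsto F f" "L2_tendsto (\<lambda>k. fourier_integral (F k)) g"
    using is_fourier_transformD[OF assms(3)] by blast
  obtain F' where F': "\<And>k. integrable lebesgue (F' k)" "\<And>k. square_integrable (F' k)"
    "L2_tendsto F' f'" "L2_tendsto (\<lambda>k. fourier_integral (F' k)) g'"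
    using is_fourier_transformD[OF assms(4)] by blast
  note g = assms(3,4)[THEN is_fourier_transform_square_integrable]
  show ?thesis
    unfolding is_fourier_transform_def
  proof (intro conjI exI allI)
    show "square_integrable (\<lambda>\<xi>. g \<xi> - g' \<xi>)"
      by (intro square_integrable_diff g)
    show "integrable lebesgue (\<lambda>x. F k x - F' k x)" "square_integrable (\<lambda>x. F k x - F' k x)" for k
      using F F' by (auto intro: square_integrable_diff)
    show "L2_tendsto (\<lambda>k x. F k x - F' k x) (\<lambda>x. f x - f' x)"
      by (intro L2_tendsto_diff square_integrable_measurable F F' f)
    have "L2_tendsto (\<lambda>k \<xi>. fourier_integral (F k) \<xi> - fourier_integral (F' k) \<xi>) (\<lambda>\<xi>. g \<xi> - g' \<xi>)"
      by (intro L2_tendsto_diff fourier_integral_measurable F F' square_integrable_measurable g)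
    then show "L2_tendsto (\<lambda>k. fourier_integral (\<lambda>x. F k x - F' k x)) (\<lambda>\<xi>. g \<xi> - g' \<xi>)"
      by (simp add: fourier_integral_diff_fun[OF F(1) F'(1)])
  qed
qed

lemma is_fourier_transform_sqnorm:
  assumes "f \<in> borel_measurable lebesgue" "is_fourier_transform f g"
  shows "sqnorm g = sqnorm f"
proof -
  obtain F where F: "\<And>k. integrable lebesgue (F k)" "\<And>k. square_integrable (F k)"
    "L2_tendsto F f" "L2_tendsto (\<lambda>k. fourier_integral (F k)) g"
    using is_fourier_transformD[OF assms(2)] by blast
  show ?thesis
    by (rule sqnorm_eq_limit[OF _ _ _ _ F(3,4)])
       (intro square_integrable_measurable fourier_integral_measurable plancherel F assms
          is_fourier_transform_square_integrable[OF assms(2)])+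
qed

lemma is_fourier_transform_sqnorm_diff:
  assumes "f \<in> borel_measurable lebesgue" "f' \<in> borel_measurable lebesgue"
    and "is_fourier_transform f g" "is_fourier_transform f' g'"
  shows "sqnorm (\<lambda>\<xi>. g \<xi> - g' \<xi>) = sqnorm (\<lambda>x. f x - f' x)"
  using assms by (intro is_fourier_transform_sqnorm is_fourier_transform_diff) auto

lemma is_fourier_transform_unique:
  assumes "f \<in> borel_measurable lebesgue" "is_fourier_transform f g" "is_fourier_transform f g'"
  shows "AE \<xi> in lebesgue. g \<xi> = g' \<xi>"
proof -
  have "sqnorm (\<lambda>\<xi>. g \<xi> - g' \<xi>) = 0"
    using is_fourier_transform_sqnorm_diff[OF assms(1,1,2,3)] by (simp add: sqnorm_def)
  with sqnorm_eq_0[of "\<lambda>\<xi>. g \<xi> - g' \<xi>"] show ?thesis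
    using assms(2,3)[THEN is_fourier_transform_square_integrable, THEN square_integrable_measurable]
    by auto
qed

text \<open>By linearity and isometry; this identifies the function that the choice operator in the
  definition of the Schroedinger evolution picks.\<close>
lemma is_fourier_transform_inj:
  assumes "f \<in> borel_measurable lebesgue" "f' \<in> borel_measurable lebesgue"
    and "is_fourier_transform f g" "is_fourier_transform f' g'" "AE \<xi> in lebesgue. g \<xi> = g' \<xi>"
  shows "AE x in lebesgue. f x = f' x"
proof -
  have "sqnorm (\<lambda>x. f x - f' x) = sqnorm (\<lambda>\<xi>. g \<xi> - g' \<xi>)"
    using is_fourier_transform_sqnorm_diff[OF assms(1-4)] by simp
  also have "\<dots> = sqnorm (\<lambda>_ :: real ^ 'a. 0)"
    using assms(5) by (intro sqnorm_cong_AE) auto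
  finally have "sqnorm (\<lambda>x. f x - f' x) = 0" by (simp add: sqnorm_def)
  with sqnorm_eq_0[of "\<lambda>x. f x - f' x"] show ?thesis using assms(1,2) by auto
qed

lemma is_fourier_transform_L2_tendsto:
  assumes "\<And>k. f' k \<in> borel_measurable lebesgue" "f \<in> borel_measurable lebesgue"
    and "\<And>k. is_fourier_transform (f' k) (g' k)" "is_fourier_transform f g" "L2_tendsto f' f"
  shows "L2_tendsto g' g"
  using assms(5) is_fourier_transform_sqnorm_diff[OF assms(1,2,3,4)] by (simp add: L2_tendsto_iff)

text \<open>The relation is a closure, hence closed; a diagonal sequence shows it.\<close>
lemma is_fourier_transform_limit:
  fixes f g :: "real ^ 'n \<Rightarrow> complex"
  assumes f: "\<And>k. f' k \<in> borel_measurable lebesgue" "f \<in> borel_measurable lebesgue"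
    and ft: "\<And>k. is_fourier_transform (f' k) (g' k)"
    and ff: "L2_tendsto f' f" and gg: "L2_tendsto g' g" and g: "g \<in> borel_measurable lebesgue"
  shows "is_fourier_transform f g"
proof -
  note sg = ft[THEN is_fourier_transform_square_integrable]
  have "\<exists>h. integrable lebesgue h \<and> square_integrable h
      \<and> sqnorm (\<lambda>x. h x - f' k x) < ennreal (inverse (real (Suc k)))
      \<and> sqnorm (\<lambda>\<xi>. fourier_integral h \<xi> - g' k \<xi>) < ennreal (inverse (real (Suc k)))" for k
  proof -
    obtain F where F: "\<And>j. integrable lebesgue (F j)" "\<And>j. square_integrable (F j)"
      "L2_tendsto F (f' k)" "L2_tendsto (\<lambda>j. fourier_integral (F j)) (g' k)"
      using is_fourier_transformD[OF ft[of k]] by blast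
    have pos: "0 < ennreal (inverse (real (Suc k)))" by simp
    have "\<forall>\<^sub>F j in sequentially. sqnorm (\<lambda>x. F j x - f' k x) < ennreal (inverse (real (Suc k)))
       \<and> sqnorm (\<lambda>\<xi>. fourier_integral (F j) \<xi> - g' k \<xi>) < ennreal (inverse (real (Suc k)))"
      using order_tendstoD(2)[OF F(3)[unfolded L2_tendsto_iff] pos]
        order_tendstoD(2)[OF F(4)[unfolded L2_tendsto_iff] pos]
      by (rule eventually_conj)
    with F(1,2) show ?thesis by (auto simp: eventually_sequentially simp del: of_nat_Suc)
  qed
  then obtain h where h: "\<And>k. integrable lebesgue (h k)" "\<And>k. square_integrable (h k)"
    and hf: "\<And>k. sqnorm (\<lambda>x. h k x - f' k x) < ennreal (inverse (real (Suc k)))"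
    and hg: "\<And>k. sqnorm (\<lambda>\<xi>. fourier_integral (h k) \<xi> - g' k \<xi>) < ennreal (inverse (real (Suc k)))"
    by metis
  have "L2_tendsto h f"
    by (rule L2_tendsto_diagonal[OF f(1) _ f(2) ff hf]) (rule square_integrable_measurable[OF h(2)])
  moreover have "L2_tendsto (\<lambda>k. fourier_integral (h k)) g"
    by (rule L2_tendsto_diagonal[OF _ _ g gg hg])
       (rule square_integrable_measurable[OF sg] fourier_integral_measurable(2)[OF h(1)])+
  moreover have "square_integrable g"
    by (rule L2_tendsto_square_integrable[OF sg g gg])
  ultimately show ?thesis
    using h unfolding is_fourier_transform_def by blast
qed

lemma is_fourier_transform_exists:
  fixes f :: "real ^ 'n \<Rightarrow> complex"
  assumes f: "square_integrable f"
  shows "\<exists>g. is_fourier_transform f g"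
proof -
  obtain c where c: "\<And>k. c k \<in> C_c" "L2_tendsto c f" by (rule C_c_dense[OF f]) blast
  note cs = C_c_integrable_lebesgue[OF c(1)] C_c_square_integrable[OF c(1)]
  have "L2_Cauchy c"
    by (intro L2_tendsto_imp_Cauchy[OF _ _ c(2)] square_integrable_measurable cs f)
  then have "L2_Cauchy (\<lambda>k. fourier_integral (c k))"
    by (rule L2_Cauchy_mono[where c = 1]) (auto simp: sqnorm_fourier_integral_diff_C_c[OF c(1) c(1)])
  then obtain g where "square_integrable g" "L2_tendsto (\<lambda>k. fourier_integral (c k)) g"
    using L2_complete[of "\<lambda>k. fourier_integral (c k)"] fourier_integral_square_integrable[OF cs] by blast
  with cs c show ?thesis unfolding is_fourier_transform_def by blast
qed

lemma is_fourier_transform_fourier: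
  "square_integrable f \<Longrightarrow> is_fourier_transform f (fourier f)"
  unfolding fourier_def by (rule someI_ex[OF is_fourier_transform_exists])

lemma lebesgue_scaling:
  fixes t :: "'a::euclidean_space"
  assumes c: "c \<noteq> 0"
  shows "lebesgue = density (distr lebesgue lebesgue (\<lambda>x. t + c *\<^sub>R x)) (\<lambda>_. ennreal (\<bar>c\<bar> ^ DIM('a)))"
    and "(\<lambda>x. t + c *\<^sub>R x) \<in> lebesgue \<rightarrow>\<^sub>M lebesgue"
  using lebesgue_affine_euclidean[where c="\<lambda>_::'a. c" and t=t] lebesgue_affine_measurable[where c="\<lambda>_::'a. c" and t=t] c
  unfolding scaleR_scaleR[symmetric] scaleR_sum_right[symmetric] euclidean_representation prod_constant
  by (simp_all add: ennreal_power)

lemma scaling_measurable: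
  fixes f :: "real ^ 'n \<Rightarrow> 'b::topological_space"
  assumes "f \<in> borel_measurable lebesgue" "c \<noteq> 0"
  shows "(\<lambda>x. f (c *\<^sub>R x)) \<in> borel_measurable lebesgue"
  using measurable_compose[OF lebesgue_scaling(2)[OF assms(2), of 0] assms(1)] by simp

lemma sqnorm_scaling:
  fixes f :: "real ^ 'n \<Rightarrow> complex"
  assumes [measurable]: "f \<in> borel_measurable lebesgue" and c: "c \<noteq> 0"
  shows "sqnorm f = ennreal (\<bar>c\<bar> ^ CARD('n)) * sqnorm (\<lambda>x. f (c *\<^sub>R x))"
proof -
  have [measurable]: "(\<lambda>x :: real ^ 'n. 0 + c *\<^sub>R x) \<in> lebesgue \<rightarrow>\<^sub>M lebesgue"
    by (rule lebesgue_scaling(2)[OF c])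
  have "sqnorm f = (\<integral>\<^sup>+ x. ennreal ((cmod (f x))\<^sup>2)
      \<partial>density (distr lebesgue lebesgue (\<lambda>x. 0 + c *\<^sub>R x)) (\<lambda>_. ennreal (\<bar>c\<bar> ^ DIM(real ^ 'n))))"
    unfolding sqnorm_def by (subst lebesgue_scaling(1)[OF c, of 0]) (rule refl)
  also have "\<dots> = ennreal (\<bar>c\<bar> ^ CARD('n)) * sqnorm (\<lambda>x. f (0 + c *\<^sub>R x))"
    by (subst nn_integral_density) (auto simp: nn_integral_cmult nn_integral_distr sqnorm_def)
  finally show ?thesis by simp
qed

lemma L2_tendsto_scaling:
  fixes f :: "real ^ 'n \<Rightarrow> complex"
  assumes F: "\<And>k. F k \<in> borel_measurable lebesgue" and f: "f \<in> borel_measurable lebesgue"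
    and c: "c \<noteq> 0" and Ff: "L2_tendsto F f"
  shows "L2_tendsto (\<lambda>k x. F k (c *\<^sub>R x)) (\<lambda>x. f (c *\<^sub>R x))"
  unfolding L2_tendsto_iff
proof (rule ennreal_tendsto_0_le[OF Ff[unfolded L2_tendsto_iff], where c = "ennreal (inverse \<bar>c\<bar> ^ CARD('n))"])
  fix k
  have "sqnorm (\<lambda>x. F k x - f x) = ennreal (\<bar>c\<bar> ^ CARD('n)) * sqnorm (\<lambda>x. F k (c *\<^sub>R x) - f (c *\<^sub>R x))"
    by (intro sqnorm_scaling borel_measurable_diff F f c)
  moreover have "ennreal (inverse \<bar>c\<bar> ^ CARD('n)) * ennreal (\<bar>c\<bar> ^ CARD('n)) = 1"
    using c by (simp add: ennreal_mult[symmetric] power_mult_distrib[symmetric])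
  ultimately show "sqnorm (\<lambda>x. F k (c *\<^sub>R x) - f (c *\<^sub>R x))
      \<le> ennreal (inverse \<bar>c\<bar> ^ CARD('n)) * sqnorm (\<lambda>x. F k x - f x)"
    by (simp add: mult.assoc[symmetric])
qed simp

lemma square_integrable_scaling:
  fixes f :: "real ^ 'n \<Rightarrow> complex"
  assumes f: "square_integrable f" and c: "c \<noteq> 0"
  shows "square_integrable (\<lambda>x. f (c *\<^sub>R x))"
proof -
  have "ennreal (\<bar>c\<bar> ^ CARD('n)) * sqnorm (\<lambda>x. f (c *\<^sub>R x)) < \<infinity>"
    using f sqnorm_scaling[OF square_integrable_measurable[OF f] c] by (simp add: square_integrable_iff)
  then have "sqnorm (\<lambda>x. f (c *\<^sub>R x)) < \<infinity>"
    using c by (auto simp: ennreal_mult_less_top)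
  then show ?thesis
    using scaling_measurable[OF square_integrable_measurable[OF f] c] by (simp add: square_integrable_iff)
qed

lemma L2_tendsto_bounded_mult:
  assumes F: "\<And>k. F k \<in> borel_measurable lebesgue" and f: "f \<in> borel_measurable lebesgue"
    and m: "\<And>x. cmod (m x) \<le> C" and Ff: "L2_tendsto F f"
  shows "L2_tendsto (\<lambda>k x. m x * F k x) (\<lambda>x. m x * f x)"
  unfolding L2_tendsto_iff
proof (rule ennreal_tendsto_0_le[OF Ff[unfolded L2_tendsto_iff], where c = "ennreal ((cmod (of_real C))\<^sup>2)"])
  fix k
  have "0 \<le> C" using m[of undefined] norm_ge_zero order_trans by blast
  have "sqnorm (\<lambda>x. m x * F k x - m x * f x) \<le> sqnorm (\<lambda>x. of_real C * (F k x - f x))"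
    by (rule sqnorm_mono)
       (use m \<open>0 \<le> C\<close> in \<open>auto simp: norm_mult right_diff_distrib[symmetric] intro!: mult_right_mono\<close>)
  also have "\<dots> = ennreal ((cmod (of_real C))\<^sup>2) * sqnorm (\<lambda>x. F k x - f x)"
    by (intro sqnorm_scale borel_measurable_diff F f)
  finally show "sqnorm (\<lambda>x. m x * F k x - m x * f x)
      \<le> ennreal ((cmod (of_real C))\<^sup>2) * sqnorm (\<lambda>x. F k x - f x)" .
qed simp

lemma gauss_times_fourier_square_integrable:
  assumes z: "0 \<le> Re z" and h: "h \<in> C_c"
  shows "square_integrable (\<lambda>\<xi>. gauss z \<xi> * fourier_integral h \<xi>)"
  by (intro square_integrable_bounded_mult[where C = 1] fourier_integral_square_integrable
      C_c_integrable_lebesgue C_c_square_integrable h norm_gauss_le z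
      continuous_measurable_lebesgue continuous_intros)

text \<open>The inverse transform of a test function need not be integrable, so it is damped by
  Gaussians with parameter \<open>e k\<close>. The transforms of the damped functions are the
  Gaussian averages of \<open>g\<close>; they converge pointwise to \<open>g\<close> and form a
  Cauchy sequence in the mean square, so they converge to \<open>g\<close> there too.\<close>
lemma fourier_inversion_C_c:
  fixes g :: "real ^ 'n \<Rightarrow> complex"
  assumes g: "g \<in> C_c"
  shows "is_fourier_transform (\<lambda>x. fourier_integral g (- x)) g"
proof -
  define e where "e = (\<lambda>k. inverse (real (Suc k)))"
  have e: "0 < e k" "e \<longlonglongrightarrow> 0" for k
    unfolding e_def using LIMSEQ_inverse_real_of_nat by auto
  let ?g = "\<lambda>k. gauss (complex_of_real (e k))"
  note gl = C_c_integrable_lebesgue[OF g] and gs = C_c_square_integrable[OF g]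
  note fg = fourier_integral_square_integrable(1)[OF gl gs]
  define P where "P = (\<lambda>k \<xi>. ?g k \<xi> * fourier_integral g \<xi>)"
  have P_int: "integrable lborel (P k)" for k
    unfolding P_def using e by (intro gauss_times_fourier_integrable gl) simp
  have P_sq: "square_integrable (P k)" for k
    unfolding P_def using e(1)[of k] by (intro gauss_times_fourier_square_integrable g) simp
  have P_L2: "L2_tendsto P (fourier_integral g)"
  proof (rule L2_tendsto_dominated[OF _ _ _ fg])
    show "AE x in lebesgue. (\<lambda>k. P k x) \<longlonglongrightarrow> fourier_integral g x"
    proof (rule AE_I2)
      fix x
      have "(\<lambda>k. P k x) \<longlonglongrightarrow> gauss (complex_of_real 0) x * fourier_integral g x"
        unfolding P_def gauss_def by (intro tendsto_intros e) auto
      then show "(\<lambda>k. P k x) \<longlonglongrightarrow> fourier_integral g x" by (simp add: gauss_def)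
    qed
    show "cmod (P k x) \<le> cmod (fourier_integral g x)" for k x
      unfolding P_def norm_mult using e(1)[of k] by (intro mult_left_le_one_le norm_gauss_le) auto
  qed (intro square_integrable_measurable P_sq fg)+
  \<comment> \<open>The inverse transform is the transform at the reflected point.\<close>
  define F where "F = (\<lambda>k x. P k (- x))"
  have F_L2: "L2_tendsto F (\<lambda>x. fourier_integral g (- x))"
    using L2_tendsto_scaling[OF _ _ _ P_L2, of "- 1"] P_sq fg
    by (auto simp: F_def intro: square_integrable_measurable)
  have F_int: "integrable lebesgue (F k)" for k
  proof -
    have "integrable lborel (\<lambda>x. ?g k x * fourier_integral (\<lambda>y. g (- y)) x)"
      using e by (intro gauss_times_fourier_integrable C_c_integrable_lebesgue C_c_reflect g) simp
    also have "(\<lambda>x. ?g k x * fourier_integral (\<lambda>y. g (- y)) x) = F k"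
      by (simp add: F_def P_def fourier_integral_reflect[OF C_c_measurable[OF g]] gauss_def fun_eq_iff)
    finally show ?thesis by (rule integrable_lebesgue_of_lborel)
  qed
  have F_sq: "square_integrable (F k)" for k
    using square_integrable_scaling[OF P_sq, of "- 1" k] by (simp add: F_def)
  have F_conv: "fourier_integral (F k) = gauss_conv (complex_of_real (e k)) g" for k
    using e fourier_inverse_gauss_times_fourier[OF _ C_c_integrable[OF g], of "complex_of_real (e k)"]
      fourier_integral_reflect[OF borel_measurable_integrable[OF P_int[of k], simplified]]
    by (auto simp: F_def P_def)
  have "L2_Cauchy F"
    by (rule L2_tendsto_imp_Cauchy[OF _ _ F_L2])
       (use F_sq square_integrable_scaling[OF fg, of "- 1"] in \<open>auto intro: square_integrable_measurable\<close>)
  then have "L2_Cauchy (\<lambda>k. fourier_integral (F k))"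
  proof (rule L2_Cauchy_mono[where c = 1])
    fix j k
    have "sqnorm (fourier_integral (\<lambda>x. F j x - F k x)) = sqnorm (\<lambda>x. F j x - F k x)"
      by (intro plancherel Bochner_Integration.integrable_diff square_integrable_diff F_int F_sq)
    then show "sqnorm (\<lambda>x. fourier_integral (F j) x - fourier_integral (F k) x) \<le> 1 * sqnorm (\<lambda>x. F j x - F k x)"
      by (simp add: fourier_integral_diff_fun[OF F_int F_int])
  qed simp
  then have "L2_tendsto (\<lambda>k. fourier_integral (F k)) g"
  proof (rule L2_Cauchy_pointwise[where r = id, rotated 2])
    show "AE x in lebesgue. (\<lambda>k. fourier_integral (F (id k)) x) \<longlonglongrightarrow> g x"
      unfolding F_conv by (intro AE_I2) (use gauss_conv_heat_tendsto[OF g e] in simp)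
  qed (auto simp: strict_mono_def intro!: fourier_integral_measurable F_int square_integrable_measurable[OF gs])
  with F_int F_sq F_L2 gs show ?thesis
    unfolding is_fourier_transform_def by blast
qed

lemma fourier_inversion:
  fixes g :: "real ^ 'n \<Rightarrow> complex"
  assumes g: "integrable lebesgue g" "square_integrable g"
  shows "is_fourier_transform (\<lambda>x. fourier_integral g (- x)) g"
proof -
  obtain c where c: "\<And>k. c k \<in> C_c" "L2_tendsto c g" "L2_tendsto (\<lambda>k. fourier_integral (c k)) (fourier_integral g)"
    using fourier_integral_C_c_approx[OF g] by blast
  note m = fourier_integral_measurable(2)[OF C_c_integrable_lebesgue[OF c(1)]] fourier_integral_measurable(2)[OF g(1)]
  have "L2_tendsto (\<lambda>k x. fourier_integral (c k) (- x)) (\<lambda>x. fourier_integral g (- x))"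
    using L2_tendsto_scaling[OF m _ c(3), of "- 1"] by simp
  then show ?thesis
    using scaling_measurable[OF m(1), of "- 1"] scaling_measurable[OF m(2), of "- 1"] g(2)
    by (intro is_fourier_transform_limit[OF _ _ fourier_inversion_C_c[OF c(1)] _ c(2)])
       (auto intro: square_integrable_measurable)
qed

section \<open>The free Schroedinger evolution\<close>

text \<open>The bilinear term in \<open>\<bar>y - x\<bar>\<^sup>2\<close> is what makes a Fourier
  kernel appear when the parameter \<open>w\<close> is imaginary.\<close>
lemma gauss_diff:
  fixes x y :: "'a::real_inner"
  shows "gauss w (y - x) = gauss w x * (gauss w y * exp (w * complex_of_real (y \<bullet> x)))"
proof -
  have "(norm (y - x))\<^sup>2 = (norm y)\<^sup>2 + (norm x)\<^sup>2 - 2 * (y \<bullet> x)"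
    by (simp add: power2_norm_eq_inner inner_diff_left inner_diff_right inner_commute)
  then have *: "complex_of_real ((norm (y - x))\<^sup>2)
      = complex_of_real ((norm y)\<^sup>2) + complex_of_real ((norm x)\<^sup>2) - 2 * complex_of_real (y \<bullet> x)"
    by (simp only: of_real_add of_real_diff of_real_mult of_real_numeral)
  have "- w * complex_of_real ((norm (y - x))\<^sup>2) / 2
     = - w * complex_of_real ((norm x)\<^sup>2) / 2 + (- w * complex_of_real ((norm y)\<^sup>2) / 2 + w * complex_of_real (y \<bullet> x))"
    unfolding * by (simp add: algebra_simps add_divide_distrib diff_divide_distrib)
  then show ?thesis
    by (simp only: gauss_def exp_add)
qed

text \<open>The function \<open>exp (\<i> \<bar>x\<bar>\<^sup>2 / (4 T))\<close>, written as a
  Gaussian with imaginary parameter.\<close>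
definition chirp :: "real \<Rightarrow> real ^ 'n \<Rightarrow> complex" where
  "chirp T = gauss (1 / (\<i> * complex_of_real (2 * T)))"

lemma norm_chirp: "cmod (chirp T x) = 1"
  by (simp add: chirp_def norm_gauss Re_divide)

lemma chirp_continuous: "continuous_on S (chirp T)"
  unfolding chirp_def by (rule gauss_continuous)

lemma chirp_square_integrable:
  "square_integrable f \<Longrightarrow> square_integrable (\<lambda>y. chirp T y * f y)"
  by (intro square_integrable_bounded_mult[where C = 1] continuous_measurable_lebesgue chirp_continuous)
     (simp_all add: norm_chirp)

text \<open>With \<open>g\<close> the Fourier transform of \<open>chirp T\<close> times the initial
  value, this is the explicit solution of the free Schroedinger equation at time
  \<open>T\<close>.\<close>
definition dispersive_solution :: "real \<Rightarrow> (real ^ 'n \<Rightarrow> complex) \<Rightarrow> real ^ 'n \<Rightarrow> complex" where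
  "dispersive_solution T g x = (1 / csqrt (\<i> * complex_of_real (2 * T))) ^ CARD('n) * chirp T x * g ((1 / (2 * T)) *\<^sub>R x)"

text \<open>At \<open>z = 2 \<i> T\<close> the convolution with a Gaussian is the integral of
  \<open>h\<close> against the Schroedinger kernel. Expanding the square in the exponent splits the
  kernel into two chirps and the Fourier kernel at frequency \<open>x / (2 T)\<close>.\<close>
lemma gauss_conv_imaginary:
  fixes h :: "real ^ 'n \<Rightarrow> complex"
  assumes [measurable]: "h \<in> borel_measurable borel"
  shows "gauss_conv (\<i> * complex_of_real (2 * T)) h = dispersive_solution T (fourier_integral (\<lambda>y. chirp T y * h y))"
proof
  fix x :: "real ^ 'n"
  have [measurable]: "(chirp T :: real ^ 'n \<Rightarrow> complex) \<in> borel_measurable borel"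
    by (intro borel_measurable_continuous_onI chirp_continuous)
  let ?w = "1 / (\<i> * complex_of_real (2 * T))"
  have phase: "?w * complex_of_real (y \<bullet> x) = - \<i> * complex_of_real (y \<bullet> ((1 / (2 * T)) *\<^sub>R x))" for y
  proof -
    have "?w = - \<i> * complex_of_real (1 / (2 * T))"
      by (simp add: complex_eq_iff Re_divide Im_divide power2_eq_square)
    then show ?thesis by simp
  qed
  have "(LINT y|lborel. h y * gauss ?w (y - x))
      = (LINT y|lborel. chirp T x * (chirp T y * h y * exp (- \<i> * complex_of_real (y \<bullet> ((1 / (2 * T)) *\<^sub>R x)))))"
    unfolding gauss_diff phase chirp_def by (simp only: ac_simps)
  also have "\<dots> = chirp T x * (LINT y|lborel. chirp T y * h y * exp (- \<i> * complex_of_real (y \<bullet> ((1 / (2 * T)) *\<^sub>R x))))"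
    by (rule integral_mult_right_zero)
  finally show "gauss_conv (\<i> * complex_of_real (2 * T)) h x = dispersive_solution T (fourier_integral (\<lambda>y. chirp T y * h y)) x"
    by (simp add: gauss_conv_def dispersive_solution_def fourier_integral_lborel)
qed

text \<open>Regularised inversion with \<open>z k = 2 \<i> T + 1 / (k + 1)\<close> gives functions
  whose transforms are \<open>fourier_integral h\<close> times a decaying Gaussian. As
  \<open>k\<close> grows, the transforms converge in the mean square by domination, and the
  functions converge pointwise because the integrand is dominated by \<open>\<bar>h\<bar>\<close>
  and the square root is continuous away from the negative reals.\<close>
lemma dispersive_formula_C_c:
  fixes h :: "real ^ 'n \<Rightarrow> complex"
  assumes h: "h \<in> C_c" and T: "0 < T"
  shows "is_fourier_transform (dispersive_solution T (fourier_integral (\<lambda>y. chirp T y * h y)))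
     (\<lambda>\<xi>. gauss (\<i> * complex_of_real (2 * T)) \<xi> * fourier_integral h \<xi>)"
proof -
  define z where "z = (\<lambda>k. complex_of_real (inverse (real (Suc k))) + \<i> * complex_of_real (2 * T))"
  let ?z0 = "\<i> * complex_of_real (2 * T)"
  have z: "0 < Re (z k)" for k by (simp add: z_def)
  have "z \<longlonglongrightarrow> complex_of_real 0 + ?z0"
    unfolding z_def by (intro tendsto_intros LIMSEQ_inverse_real_of_nat)
  then have z_lim: "z \<longlonglongrightarrow> ?z0" by simp
  have z0: "?z0 \<notin> \<real>\<^sub>\<le>\<^sub>0" "?z0 \<noteq> 0" using T by (auto simp: complex_nonpos_Reals_iff)
  note hb = C_c_integrable[OF h] and hl = C_c_integrable_lebesgue[OF h]
  note [measurable] = C_c_measurable[OF h]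
  define P where "P = (\<lambda>k \<xi>. gauss (z k) \<xi> * fourier_integral h \<xi>)"
  have P_int: "integrable lebesgue (P k)" for k
    unfolding P_def by (intro integrable_lebesgue_of_lborel gauss_times_fourier_integrable z hl)
  have P_sq: "square_integrable (P k)" for k
    unfolding P_def by (intro gauss_times_fourier_square_integrable h less_imp_le z)
  have P0: "square_integrable (\<lambda>\<xi>. gauss ?z0 \<xi> * fourier_integral h \<xi>)"
    by (intro gauss_times_fourier_square_integrable h) simp
  have P_L2: "L2_tendsto P (\<lambda>\<xi>. gauss ?z0 \<xi> * fourier_integral h \<xi>)"
  proof (rule L2_tendsto_dominated)
    show "AE \<xi> in lebesgue. (\<lambda>k. P k \<xi>) \<longlonglongrightarrow> gauss ?z0 \<xi> * fourier_integral h \<xi>"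
      unfolding P_def gauss_def by (intro AE_I2 tendsto_intros z_lim) simp
    show "square_integrable (fourier_integral h)"
      by (intro fourier_integral_square_integrable hl C_c_square_integrable h)
    show "cmod (P k \<xi>) \<le> cmod (fourier_integral h \<xi>)" for k \<xi>
      unfolding P_def norm_mult using z[of k] by (intro mult_left_le_one_le norm_gauss_le) auto
  qed (intro square_integrable_measurable P_sq P0)+
  have ft: "is_fourier_transform (gauss_conv (z k) h) (P k)" for k
  proof -
    have "(\<lambda>x. fourier_integral (P k) (- x)) = gauss_conv (z k) h"
      unfolding P_def by (rule ext) (rule fourier_inverse_gauss_times_fourier[OF z hb])
    with fourier_inversion[OF P_int[of k] P_sq[of k]] show ?thesis by simp
  qed
  have conv_meas: "gauss_conv (z k) h \<in> borel_measurable lebesgue" for k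
  proof -
    have "(\<lambda>x. fourier_integral (P k) ((- 1) *\<^sub>R x)) = gauss_conv (z k) h"
      unfolding P_def by (rule ext) (use fourier_inverse_gauss_times_fourier[OF z hb] in simp)
    with scaling_measurable[OF fourier_integral_measurable(2)[OF P_int[of k]], of "- 1"]
    show ?thesis by simp
  qed
  have lim: "(\<lambda>k. gauss_conv (z k) h x) \<longlonglongrightarrow> gauss_conv ?z0 h x" for x
  proof -
    have "(\<lambda>k. LINT y|lborel. h y * gauss (1 / z k) (y - x)) \<longlonglongrightarrow> (LINT y|lborel. h y * gauss (1 / ?z0) (y - x))"
    proof (rule integral_dominated_convergence[where w = "\<lambda>y. cmod (h y)"])
      show "AE y in lborel. (\<lambda>k. h y * gauss (1 / z k) (y - x)) \<longlonglongrightarrow> h y * gauss (1 / ?z0) (y - x)"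
        unfolding gauss_def by (intro AE_I2 tendsto_intros z_lim z0) simp
      show "AE y in lborel. norm (h y * gauss (1 / z k) (y - x)) \<le> cmod (h y)" for k
      proof (rule AE_I2)
        fix y
        have "0 \<le> Re (1 / z k)" using z[of k] by (simp add: Re_divide)
        then show "norm (h y * gauss (1 / z k) (y - x)) \<le> cmod (h y)"
          unfolding norm_mult by (intro mult_right_le_one_le norm_gauss_le) auto
      qed
    qed (use hb in auto)
    moreover have "(\<lambda>k. csqrt (z k)) \<longlonglongrightarrow> csqrt ?z0"
      using z0(1) by (intro isCont_tendsto_compose[OF _ z_lim] continuous_at_csqrt)
    ultimately show ?thesis
      unfolding gauss_conv_def using z0(2) by (intro tendsto_intros) auto
  qed
  have lim_meas: "gauss_conv ?z0 h \<in> borel_measurable lebesgue"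
    by (rule borel_measurable_LIMSEQ_metric[OF conv_meas lim])
  have "L2_Cauchy P"
    by (intro L2_tendsto_imp_Cauchy[OF _ _ P_L2] square_integrable_measurable P_sq P0)
  then have "L2_Cauchy (\<lambda>k. gauss_conv (z k) h)"
    by (rule L2_Cauchy_mono[where c = 1])
       (simp_all add: is_fourier_transform_sqnorm_diff[OF conv_meas conv_meas ft ft])
  then have "L2_tendsto (\<lambda>k. gauss_conv (z k) h) (gauss_conv ?z0 h)"
    by (rule L2_Cauchy_pointwise[where r = id, OF conv_meas lim_meas])
       (simp add: strict_mono_def, intro AE_I2, simp only: id_apply lim)
  from is_fourier_transform_limit[OF conv_meas lim_meas ft this P_L2 square_integrable_measurable[OF P0]]
  show ?thesis
    by (simp only: gauss_conv_imaginary[OF C_c_measurable[OF h]])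
qed

lemma dispersive_solution_L2:
  fixes g :: "real ^ 'n \<Rightarrow> complex"
  assumes T: "0 < T"
  shows "square_integrable g \<Longrightarrow> square_integrable (dispersive_solution T g)"
    and "(\<And>k. square_integrable (G k)) \<Longrightarrow> square_integrable g \<Longrightarrow> L2_tendsto G g
      \<Longrightarrow> L2_tendsto (\<lambda>k. dispersive_solution T (G k)) (dispersive_solution T g)"
proof -
  let ?m = "\<lambda>x :: real ^ 'n. (1 / csqrt (\<i> * complex_of_real (2 * T))) ^ CARD('n) * chirp T x"
  let ?C = "cmod ((1 / csqrt (\<i> * complex_of_real (2 * T))) ^ CARD('n))"
  have m: "cmod (?m x) \<le> ?C" for x by (simp add: norm_mult norm_chirp)
  have c: "1 / (2 * T) \<noteq> 0" using T by simp
  have mm: "?m \<in> borel_measurable lebesgue"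
    by (intro continuous_measurable_lebesgue continuous_intros chirp_continuous)
  show "square_integrable (dispersive_solution T g)" if "square_integrable g"
    unfolding dispersive_solution_def[abs_def]
    by (rule square_integrable_bounded_mult[OF square_integrable_scaling[OF that c] mm m])
  show "L2_tendsto (\<lambda>k. dispersive_solution T (G k)) (dispersive_solution T g)"
    if "\<And>k. square_integrable (G k)" "square_integrable g" "L2_tendsto G g"
    unfolding dispersive_solution_def[abs_def]
    by (rule L2_tendsto_bounded_mult[OF _ _ m L2_tendsto_scaling[OF _ _ c that(3)]])
       (intro scaling_measurable square_integrable_measurable that c)+
qed

text \<open>Both sides depend continuously on \<open>f\<close> in the mean square, so the case of
  test functions extends to all \<open>f\<close>.\<close>
lemma dispersive_formula:
  fixes f :: "real ^ 'n \<Rightarrow> complex"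
  assumes f: "square_integrable f" and T: "0 < T"
  shows "is_fourier_transform (dispersive_solution T (fourier (\<lambda>y. chirp T y * f y)))
     (\<lambda>\<xi>. gauss (\<i> * complex_of_real (2 * T)) \<xi> * fourier f \<xi>)"
proof -
  obtain c where c: "\<And>k. c k \<in> C_c" "L2_tendsto c f" by (rule C_c_dense[OF f]) blast
  note cs = C_c_square_integrable[OF c(1)]
  have cc: "(\<lambda>y. chirp T y * c k y) \<in> C_c" for k
    by (intro C_c_mult chirp_continuous c)
  have ft: "is_fourier_transform d (fourier_integral d)" if "d \<in> C_c" for d :: "real ^ 'n \<Rightarrow> complex"
    by (intro is_fourier_transform_fourier_integral C_c_integrable_lebesgue C_c_square_integrable that)
  have sq: "square_integrable (fourier_integral d)" if "d \<in> C_c" for d :: "real ^ 'n \<Rightarrow> complex"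
    by (rule is_fourier_transform_square_integrable[OF ft[OF that]])
  note ftf = is_fourier_transform_fourier[OF f]
    and ftcf = is_fourier_transform_fourier[OF chirp_square_integrable[OF f, of T]]
  note sqf = is_fourier_transform_square_integrable[OF ftf]
    and sqcf = is_fourier_transform_square_integrable[OF ftcf]
  have g1: "cmod (gauss (\<i> * complex_of_real (2 * T)) (\<xi> :: real ^ 'n)) \<le> 1" for \<xi>
    by (rule norm_gauss_le) simp
  have "L2_tendsto (\<lambda>k y. chirp T y * c k y) (\<lambda>y. chirp T y * f y)"
    by (rule L2_tendsto_bounded_mult[where C = 1, OF _ _ _ c(2)])
       (auto simp: norm_chirp intro: square_integrable_measurable cs f)
  then have 1: "L2_tendsto (\<lambda>k. fourier_integral (\<lambda>y. chirp T y * c k y)) (fourier (\<lambda>y. chirp T y * f y))"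
    by (intro is_fourier_transform_L2_tendsto[OF _ _ ft[OF cc] ftcf] square_integrable_measurable
        C_c_square_integrable cc chirp_square_integrable f)
  have "L2_tendsto (\<lambda>k. fourier_integral (c k)) (fourier f)"
    by (intro is_fourier_transform_L2_tendsto[OF _ _ ft[OF c(1)] ftf c(2)] square_integrable_measurable cs f)
  then have 2: "L2_tendsto (\<lambda>k \<xi>. gauss (\<i> * complex_of_real (2 * T)) \<xi> * fourier_integral (c k) \<xi>)
      (\<lambda>\<xi>. gauss (\<i> * complex_of_real (2 * T)) \<xi> * fourier f \<xi>)"
    by (intro L2_tendsto_bounded_mult[OF _ _ g1] square_integrable_measurable sq c sqf)
  show ?thesis
    by (rule is_fourier_transform_limit[OF _ _ dispersive_formula_C_c[OF c(1) T]
          dispersive_solution_L2(2)[OF T sq[OF cc] sqcf 1] 2])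
       (intro square_integrable_measurable dispersive_solution_L2(1)[OF T] sq cc sqcf
          square_integrable_bounded_mult[OF sqf _ g1] continuous_measurable_lebesgue continuous_intros)+
qed

lemma fourier_square_integrable: "square_integrable f \<Longrightarrow> square_integrable (fourier f)"
  by (rule is_fourier_transform_square_integrable[OF is_fourier_transform_fourier])

text \<open>The dispersive solution shows that a function as required by the definition of the
  evolution exists, and injectivity of the Fourier transform that the chosen one agrees with it
  almost everywhere.\<close>
lemma schrodinger_eq_dispersive:
  fixes f :: "real ^ 'n \<Rightarrow> complex"
  assumes f: "square_integrable f" and T: "0 < T"
  shows "square_integrable (schrodinger T f)"
    and "AE x in lebesgue. schrodinger T f x = dispersive_solution T (fourier (\<lambda>y. chirp T y * f y)) x"
proof -
  let ?m = "\<lambda>\<xi>. exp (- \<i> * complex_of_real (T * (norm \<xi>)\<^sup>2)) * fourier f \<xi>"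
  let ?v = "dispersive_solution T (fourier (\<lambda>y. chirp T y * f y))"
  have v: "square_integrable ?v"
    by (intro dispersive_solution_L2(1)[OF T] fourier_square_integrable chirp_square_integrable f)
  have ft: "is_fourier_transform ?v ?m"
    using dispersive_formula[OF f T] by (simp add: gauss_def mult.assoc)
  have "AE \<xi> in lebesgue. fourier ?v \<xi> = ?m \<xi>"
    by (rule is_fourier_transform_unique[OF square_integrable_measurable[OF v] is_fourier_transform_fourier[OF v] ft])
  with v have "\<exists>u. square_integrable u \<and> (AE \<xi> in lebesgue. fourier u \<xi> = ?m \<xi>)" by blast
  from someI_ex[OF this]
  have u: "square_integrable (schrodinger T f)" "AE \<xi> in lebesgue. fourier (schrodinger T f) \<xi> = ?m \<xi>"
    by (simp_all add: schrodinger_def)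
  then show "square_integrable (schrodinger T f)" by simp
  show "AE x in lebesgue. schrodinger T f x = ?v x"
    by (rule is_fourier_transform_inj[OF u(1)[THEN square_integrable_measurable] v[THEN square_integrable_measurable]
          is_fourier_transform_fourier[OF u(1)] ft u(2)])
qed

lemma lebesgue_integral_scaling:
  fixes f :: "real ^ 'n \<Rightarrow> real"
  assumes [measurable]: "f \<in> borel_measurable lebesgue" and c: "c \<noteq> 0"
  shows "(LINT x|lebesgue. f x) = \<bar>c\<bar> ^ CARD('n) * (LINT x|lebesgue. f (c *\<^sub>R x))"
proof -
  have [measurable]: "(\<lambda>x :: real ^ 'n. 0 + c *\<^sub>R x) \<in> lebesgue \<rightarrow>\<^sub>M lebesgue"
    by (rule lebesgue_scaling(2)[OF c])
  have "(LINT x|lebesgue. f x)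
      = (LINT x|density (distr lebesgue lebesgue (\<lambda>x. 0 + c *\<^sub>R x)) (\<lambda>_. ennreal (\<bar>c\<bar> ^ DIM(real ^ 'n))). f x)"
    by (subst lebesgue_scaling(1)[OF c, of 0]) (rule refl)
  also have "\<dots> = \<bar>c\<bar> ^ CARD('n) * (LINT x|lebesgue. f (0 + c *\<^sub>R x))"
    by (subst integral_density) (auto simp: integral_distr)
  finally show ?thesis by simp
qed

text \<open>Up to factors of modulus 1, the evolved function at \<open>2 T y\<close> is \<open>(2
  T)\<close> to the power \<open>- n / 2\<close> times the transform at \<open>y\<close>; the square
  of the factor cancels the Jacobian of the dilation that maps \<open>B\<close> onto \<open>2 T
  B\<close>.\<close>
lemma observed_energy_eq:
  fixes f :: "real ^ 'n \<Rightarrow> complex"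
  assumes f: "square_integrable f" and T: "0 < T" and B: "B \<in> sets lebesgue"
  shows "(LINT x:((\<lambda>y. (2 * T) *\<^sub>R y) ` B)|lebesgue. (cmod (schrodinger T f x))\<^sup>2)
    = (LINT \<xi>:B|lebesgue. (cmod (fourier (\<lambda>y. chirp T y * f y) \<xi>))\<^sup>2)"
proof -
  let ?S = "(\<lambda>y :: real ^ 'n. (2 * T) *\<^sub>R y) ` B"
  let ?g = "fourier (\<lambda>y. chirp T y * f y)"
  let ?v = "dispersive_solution T ?g"
  have v: "square_integrable ?v" and g: "square_integrable ?g"
    by (intro dispersive_solution_L2(1)[OF T] fourier_square_integrable chirp_square_integrable f)+
  have T2: "2 * T \<noteq> 0" using T by simp
  have S_eq: "(\<lambda>x. (1 / (2 * T)) *\<^sub>R x) -` B \<inter> space lebesgue = ?S"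
    using T by (force simp: image_iff)
  have S: "?S \<in> sets lebesgue"
    using measurable_sets[OF lebesgue_scaling(2)[of "1 / (2 * T)" 0] B] T S_eq by simp
  have v_norm: "(cmod (?v ((2 * T) *\<^sub>R y)))\<^sup>2 = (1 / (2 * T)) ^ CARD('n) * (cmod (?g y))\<^sup>2" for y
  proof -
    have "(cmod (csqrt (\<i> * complex_of_real (2 * T))))\<^sup>2 = 2 * T"
      using T by (simp flip: norm_power add: norm_mult)
    then have "((1 / cmod (csqrt (\<i> * complex_of_real (2 * T)))) ^ CARD('n))\<^sup>2 = (1 / (2 * T)) ^ CARD('n)"
      by (simp only: power_even_eq[symmetric] power_mult[symmetric] mult.commute[of _ 2])
         (simp only: power_mult power_divide one_power2)
    then show ?thesis
      using T by (simp add: dispersive_solution_def norm_mult norm_divide norm_power norm_chirp power_mult_distrib)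
  qed
  have "(LINT x:?S|lebesgue. (cmod (schrodinger T f x))\<^sup>2) = (LINT x:?S|lebesgue. (cmod (?v x))\<^sup>2)"
  proof (rule set_lebesgue_integral_cong_AE)
    show "AE x\<in>?S in lebesgue. (cmod (schrodinger T f x))\<^sup>2 = (cmod (?v x))\<^sup>2"
      using schrodinger_eq_dispersive(2)[OF f T] by eventually_elim simp
  qed (use S schrodinger_eq_dispersive(1)[OF f T] v in measurable)
  also have "\<dots> = \<bar>2 * T\<bar> ^ CARD('n) * (LINT y|lebesgue. indicator ?S ((2 * T) *\<^sub>R y) *\<^sub>R (cmod (?v ((2 * T) *\<^sub>R y)))\<^sup>2)"
    unfolding set_lebesgue_integral_def
    by (rule lebesgue_integral_scaling[OF _ T2]) (use S v in measurable)
  also have "(\<lambda>y. indicator ?S ((2 * T) *\<^sub>R y) *\<^sub>R (cmod (?v ((2 * T) *\<^sub>R y)))\<^sup>2)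
      = (\<lambda>y. (1 / (2 * T)) ^ CARD('n) * (indicator B y *\<^sub>R (cmod (?g y))\<^sup>2))"
    unfolding v_norm using T by (auto simp: indicator_def fun_eq_iff)
  also have "\<bar>2 * T\<bar> ^ CARD('n) * (LINT y|lebesgue. (1 / (2 * T)) ^ CARD('n) * (indicator B y *\<^sub>R (cmod (?g y))\<^sup>2))
      = (LINT y:B|lebesgue. (cmod (?g y))\<^sup>2)"
    using T by (simp add: set_lebesgue_integral_def power_divide)
  finally show ?thesis .
qed

text \<open>Multiplication by a chirp is a bijection of the square integrable functions that
  preserves the modulus pointwise. Hence either inequality for a function is the other one for its
  chirped version; a single time, here 1, suffices to recover the uncertainty inequality.\<close>
lemma uncertainty_iff_observability:
  fixes A B :: "(real ^ 'n) set"
  assumes B: "B \<in> sets lebesgue"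
  shows "uncertainty_inequality C A B \<longleftrightarrow> observability_inequality C A B"
proof
  assume unc: "uncertainty_inequality C A B"
  show "observability_inequality C A B"
    unfolding observability_inequality_def
  proof (intro allI impI)
    fix T :: real and f :: "real ^ 'n \<Rightarrow> complex"
    assume T: "0 < T" and f: "square_integrable f"
    show "(LINT x|lebesgue. (cmod (f x))\<^sup>2) \<le> C * ((LINT x:A|lebesgue. (cmod (f x))\<^sup>2) +
        (LINT x:((\<lambda>y. (2 * T) *\<^sub>R y) ` B)|lebesgue. (cmod (schrodinger T f x))\<^sup>2))"
      using unc[unfolded uncertainty_inequality_def, rule_format, OF chirp_square_integrable[OF f, of T]]
      unfolding observed_energy_eq[OF f T B] by (simp add: norm_mult norm_chirp)
  qed
next
  assume obs: "observability_inequality C A B"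
  show "uncertainty_inequality C A B"
    unfolding uncertainty_inequality_def
  proof (intro allI impI)
    fix f :: "real ^ 'n \<Rightarrow> complex"
    assume f: "square_integrable f"
    define u where "u = (\<lambda>y. cnj (chirp 1 y) * f y)"
    have u: "square_integrable u"
      unfolding u_def
      by (intro square_integrable_bounded_mult[where C = 1, OF f] continuous_measurable_lebesgue
          continuous_intros chirp_continuous) (simp add: norm_chirp)
    have "chirp 1 y * cnj (chirp 1 y) = 1" for y :: "real ^ 'n"
      using complex_norm_square[of "chirp 1 y"] by (simp add: norm_chirp)
    then have cu: "(\<lambda>y. chirp 1 y * u y) = f"
      by (simp add: u_def mult.assoc[symmetric])
    have "cmod (u x) = cmod (f x)" for x by (simp add: u_def norm_mult norm_chirp)
    with obs[unfolded observability_inequality_def, rule_format, OF zero_less_one u]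
    show "(LINT x|lebesgue. (cmod (f x))\<^sup>2) \<le> C * ((LINT x:A|lebesgue. (cmod (f x))\<^sup>2) +
        (LINT \<xi>:B|lebesgue. (cmod (fourier f \<xi>))\<^sup>2))"
      unfolding observed_energy_eq[OF u zero_less_one B] cu by simp
  qed
qed

theorem lemma2p3:
  fixes A B :: "(real ^ 'n) set"
  assumes "A \<in> sets lebesgue" and "B \<in> sets lebesgue"
  shows "((\<exists>C1>0. uncertainty_inequality C1 A B) \<longleftrightarrow> (\<exists>C2>0. observability_inequality C2 A B)) \<and>
         (\<forall>C>0. uncertainty_inequality C A B \<longleftrightarrow> observability_inequality C A B)"
  using uncertainty_iff_observability[OF assms(2)] by blast

end
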